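(* The matrix reachability problem, the vector reachability problem, and the scalar reachability problem are decidable over each of the semirings $\mathbb{N}_{\min}$, $\mathbb{N}_{\max}$, $\bar{\mathbb{N}}_{\max}$, $\mathscr{L}$, $\mathbb{N}$, and $\bar{\mathbb{N}}$.
   Context: The semirings are (first operation is the semiring addition, second is the semiring multiplication): - $\mathbb{N}_{\min}=(\mathbb{N}\cup\{+\infty\},\min,+)$; - $\mathbb{N}_{\max}=(\mathbb{N}\cup\{-\infty\},\max,+)$; - $\bar{\mathbb{N}}_{\max}=(\mathbb{N}\cup\{\pm\infty\},\max,+)$, with the convention $(+\infty)+(-\infty)=(-\infty)+(+\infty)=-\infty$; - $\mathscr{L}=(\mathbb{N}\cup\{\omega,+\infty\},\min,+)$, where the minimum is taken with respect to the order $0<1<2<\cdots<\omega<+\infty$, and the addition of $\mathbb{N}_{\min}$ is completed by $\omega+a=a+\omega=\max(a,\omega)$; - $\mathbb{N}=(\mathbb{N},+,\times)$; - $\bar{\mathbb{N}}=(\mathbb{N}\cup\{+\infty\},+,\times)$, with the convention $0\times(+\infty)=(+\infty)\times0=0$. Problems over a semiring $\mathscr{S}$ (number of generators $r$ and dimension $n$ arbitrary; matrix products are taken in $\mathscr{S}$): - Matrix reachability: given $n\times n$ matrices $A_1,\dots,A_r$ and $M$ with entries in $\mathscr{S}$, is there a finite sequence $1\le i_1,\dots,i_k\le r$ with $k\ge 1$ such that $A_{i_1}\cdots A_{i_k}=M$? - Vector reachability: given $n\times n$ matrices $A_1,\dots,A_r$ and $1\times n$ matrices $\alpha,\eta$ with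 entries in $\mathscr{S}$, is there a finite sequence $1\le i_1,\dots,i_k\le r$ with $k\ge1$ such that $\alpha A_{i_1}\cdots A_{i_k}=\eta$? - Scalar reachability: given $n\times n$ matrices $A_1,\dots,A_r$, a $1\times n$ matrix $\alpha$, an $n\times 1$ matrix $\beta$, all with entries in $\mathscr{S}$, and $\gamma\in\mathscr{S}$, is there a finite sequence $1\le i_1,\dots,i_k\le r$ with $k\ge1$ such that $\alpha A_{i_1}\cdots A_{i_k}\beta=\gamma$? *)

theory Defs
  imports Jordan_Normal_Form.Matrix "HOL-Library.Extended_Nat" "HOL-Library.Nat_Bijection"
begin

section \<open>Decidability\<close>

text \<open>
  Total recursive functions, in Kleene's style: minimisation is only applied to regular functions.
  An \<open>n\<close>-ary function is a function on lists; only its values on lists of length \<open>n\<close> are meaningful.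
\<close>

inductive recursive :: "nat \<Rightarrow> (nat list \<Rightarrow> nat) \<Rightarrow> bool" where
  zero: "recursive n (\<lambda>xs. 0)"
| succ: "recursive 1 (\<lambda>xs. Suc (xs ! 0))"
| proj: "i < n \<Longrightarrow> recursive n (\<lambda>xs. xs ! i)"
| comp: "\<lbrakk>recursive (length gs) f; \<forall>g \<in> set gs. recursive n g\<rbrakk>
    \<Longrightarrow> recursive n (\<lambda>xs. f (map (\<lambda>g. g xs) gs))"
| prec: "\<lbrakk>recursive n f; recursive (Suc (Suc n)) g\<rbrakk>
    \<Longrightarrow> recursive (Suc n) (\<lambda>xs. rec_nat (f (tl xs)) (\<lambda>k y. g (k # y # tl xs)) (hd xs))"
| mu: "\<lbrakk>recursive (Suc n) f; \<forall>xs. length xs = n \<longrightarrow> (\<exists>y. f (y # xs) = 0)\<rbrakk>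
    \<Longrightarrow> recursive n (\<lambda>xs. LEAST y. f (y # xs) = 0)"

definition decidable :: "nat set \<Rightarrow> bool" where
  "decidable S \<longleftrightarrow> (\<exists>f. recursive 1 f \<and> (\<forall>x. f [x] = (if x \<in> S then 1 else 0)))"


section \<open>The semirings\<close>

text \<open>
  In each tropical semiring below, \<open>+\<close> and \<open>*\<close> are the semiring operations, so \<open>+\<close> is a minimum or
  maximum and \<open>*\<close> extends the usual addition; \<open>0\<close> is the infinity that is neutral for \<open>+\<close>, and
  \<open>1\<close> is the number zero.
\<close>

subsection \<open>\<open>(\<nat> \<union> {+\<infinity>}, min, +)\<close>\<close>

datatype nmin = NMin nat | NMin_PInf

instantiation nmin :: linorder
begin

fun less_eq_nmin :: "nmin \<Rightarrow> nmin \<Rightarrow> bool" where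
  "NMin a \<le> NMin b \<longleftrightarrow> a \<le> b"
| "x \<le> NMin_PInf \<longleftrightarrow> True"
| "NMin_PInf \<le> NMin b \<longleftrightarrow> False"

definition less_nmin :: "nmin \<Rightarrow> nmin \<Rightarrow> bool" where
  "x < y \<longleftrightarrow> x \<le> y \<and> \<not> y \<le> (x :: nmin)"

instance
proof
  fix x y z :: nmin
  show "x < y \<longleftrightarrow> x \<le> y \<and> \<not> y \<le> x" by (rule less_nmin_def)
  show "x \<le> x" by (cases x) auto
  show "x \<le> y \<Longrightarrow> y \<le> z \<Longrightarrow> x \<le> z" by (cases x; cases y; cases z) auto
  show "x \<le> y \<Longrightarrow> y \<le> x \<Longrightarrow> x = y" by (cases x; cases y) auto
  show "x \<le> y \<or> y \<le> x" by (cases x; cases y) auto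
qed

end

instantiation nmin :: comm_semiring_1
begin

definition zero_nmin :: nmin where "0 = NMin_PInf"

definition one_nmin :: nmin where "1 = NMin 0"

definition plus_nmin :: "nmin \<Rightarrow> nmin \<Rightarrow> nmin" where "x + y = min x (y :: nmin)"

fun times_nmin :: "nmin \<Rightarrow> nmin \<Rightarrow> nmin" where
  "NMin a * NMin b = NMin (a + b)"
| "NMin_PInf * y = NMin_PInf"
| "x * NMin_PInf = NMin_PInf"

instance
proof
  fix x y z :: nmin
  show "x * y * z = x * (y * z)" by (cases x; cases y; cases z) auto
  show "x * y = y * x" by (cases x; cases y) auto
  show "1 * x = x" by (cases x) (auto simp: one_nmin_def)
  show "x + y + z = x + (y + z)" by (simp add: plus_nmin_def min.assoc)
  show "x + y = y + x" by (simp add: plus_nmin_def min.commute)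
  show "0 + x = x" by (cases x) (auto simp: plus_nmin_def zero_nmin_def min_def)
  show "0 * x = 0" by (cases x) (auto simp: zero_nmin_def)
  show "x * 0 = 0" by (cases x) (auto simp: zero_nmin_def)
  show "(x + y) * z = x * z + y * z"
    by (cases x; cases y; cases z) (auto simp: plus_nmin_def min_def)
  show "(0 :: nmin) \<noteq> 1" by (simp add: zero_nmin_def one_nmin_def)
qed

end

subsection \<open>\<open>(\<nat> \<union> {-\<infinity>}, max, +)\<close>\<close>

datatype nmax = NMax nat | NMax_MInf

instantiation nmax :: linorder
begin

fun less_eq_nmax :: "nmax \<Rightarrow> nmax \<Rightarrow> bool" where
  "NMax a \<le> NMax b \<longleftrightarrow> a \<le> b"
| "NMax_MInf \<le> y \<longleftrightarrow> True"
| "NMax a \<le> NMax_MInf \<longleftrightarrow> False"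

definition less_nmax :: "nmax \<Rightarrow> nmax \<Rightarrow> bool" where
  "x < y \<longleftrightarrow> x \<le> y \<and> \<not> y \<le> (x :: nmax)"

instance
proof
  fix x y z :: nmax
  show "x < y \<longleftrightarrow> x \<le> y \<and> \<not> y \<le> x" by (rule less_nmax_def)
  show "x \<le> x" by (cases x) auto
  show "x \<le> y \<Longrightarrow> y \<le> z \<Longrightarrow> x \<le> z" by (cases x; cases y; cases z) auto
  show "x \<le> y \<Longrightarrow> y \<le> x \<Longrightarrow> x = y" by (cases x; cases y) auto
  show "x \<le> y \<or> y \<le> x" by (cases x; cases y) auto
qed

end

instantiation nmax :: comm_semiring_1
begin

definition zero_nmax :: nmax where "0 = NMax_MInf"

definition one_nmax :: nmax where "1 = NMax 0"

definition plus_nmax :: "nmax \<Rightarrow> nmax \<Rightarrow> nmax" where "x + y = max x (y :: nmax)"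

fun times_nmax :: "nmax \<Rightarrow> nmax \<Rightarrow> nmax" where
  "NMax a * NMax b = NMax (a + b)"
| "NMax_MInf * y = NMax_MInf"
| "x * NMax_MInf = NMax_MInf"

instance
proof
  fix x y z :: nmax
  show "x * y * z = x * (y * z)" by (cases x; cases y; cases z) auto
  show "x * y = y * x" by (cases x; cases y) auto
  show "1 * x = x" by (cases x) (auto simp: one_nmax_def)
  show "x + y + z = x + (y + z)" by (simp add: plus_nmax_def max.assoc)
  show "x + y = y + x" by (simp add: plus_nmax_def max.commute)
  show "0 + x = x" by (cases x) (auto simp: plus_nmax_def zero_nmax_def max_def)
  show "0 * x = 0" by (cases x) (auto simp: zero_nmax_def)
  show "x * 0 = 0" by (cases x) (auto simp: zero_nmax_def)
  show "(x + y) * z = x * z + y * z"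
    by (cases x; cases y; cases z) (auto simp: plus_nmax_def max_def)
  show "(0 :: nmax) \<noteq> 1" by (simp add: zero_nmax_def one_nmax_def)
qed

end

subsection \<open>\<open>(\<nat> \<union> {-\<infinity>, +\<infinity>}, max, +)\<close>\<close>

datatype nbarmax = NBarMax nat | NBarMax_MInf | NBarMax_PInf

instantiation nbarmax :: linorder
begin

fun less_eq_nbarmax :: "nbarmax \<Rightarrow> nbarmax \<Rightarrow> bool" where
  "NBarMax a \<le> NBarMax b \<longleftrightarrow> a \<le> b"
| "NBarMax_MInf \<le> y \<longleftrightarrow> True"
| "x \<le> NBarMax_PInf \<longleftrightarrow> True"
| "NBarMax a \<le> NBarMax_MInf \<longleftrightarrow> False"
| "NBarMax_PInf \<le> NBarMax_MInf \<longleftrightarrow> False"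
| "NBarMax_PInf \<le> NBarMax b \<longleftrightarrow> False"

definition less_nbarmax :: "nbarmax \<Rightarrow> nbarmax \<Rightarrow> bool" where
  "x < y \<longleftrightarrow> x \<le> y \<and> \<not> y \<le> (x :: nbarmax)"

instance
proof
  fix x y z :: nbarmax
  show "x < y \<longleftrightarrow> x \<le> y \<and> \<not> y \<le> x" by (rule less_nbarmax_def)
  show "x \<le> x" by (cases x) auto
  show "x \<le> y \<Longrightarrow> y \<le> z \<Longrightarrow> x \<le> z" by (cases x; cases y; cases z) auto
  show "x \<le> y \<Longrightarrow> y \<le> x \<Longrightarrow> x = y" by (cases x; cases y) auto
  show "x \<le> y \<or> y \<le> x" by (cases x; cases y) auto
qed

end

instantiation nbarmax :: comm_semiring_1
begin

definition zero_nbarmax :: nbarmax where "0 = NBarMax_MInf"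

definition one_nbarmax :: nbarmax where "1 = NBarMax 0"

definition plus_nbarmax :: "nbarmax \<Rightarrow> nbarmax \<Rightarrow> nbarmax" where "x + y = max x (y :: nbarmax)"

fun times_nbarmax :: "nbarmax \<Rightarrow> nbarmax \<Rightarrow> nbarmax" where
  "NBarMax a * NBarMax b = NBarMax (a + b)"
| "NBarMax_MInf * y = NBarMax_MInf"
| "x * NBarMax_MInf = NBarMax_MInf"
| "NBarMax_PInf * y = NBarMax_PInf"
| "x * NBarMax_PInf = NBarMax_PInf"

instance
proof
  fix x y z :: nbarmax
  show "x * y * z = x * (y * z)" by (cases x; cases y; cases z) auto
  show "x * y = y * x" by (cases x; cases y) auto
  show "1 * x = x" by (cases x) (auto simp: one_nbarmax_def)
  show "x + y + z = x + (y + z)" by (simp add: plus_nbarmax_def max.assoc)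
  show "x + y = y + x" by (simp add: plus_nbarmax_def max.commute)
  show "0 + x = x" by (cases x) (auto simp: plus_nbarmax_def zero_nbarmax_def max_def)
  show "0 * x = 0" by (cases x) (auto simp: zero_nbarmax_def)
  show "x * 0 = 0" by (cases x) (auto simp: zero_nbarmax_def)
  show "(x + y) * z = x * z + y * z"
    by (cases x; cases y; cases z) (auto simp: plus_nbarmax_def max_def)
  show "(0 :: nbarmax) \<noteq> 1" by (simp add: zero_nbarmax_def one_nbarmax_def)
qed

end

subsection \<open>\<open>(\<nat> \<union> {\<omega>, +\<infinity>}, min, +)\<close>\<close>

datatype lsr = LFin nat | LOmega | LPInf

instantiation lsr :: linorder
begin

fun less_eq_lsr :: "lsr \<Rightarrow> lsr \<Rightarrow> bool" where
  "LFin a \<le> LFin b \<longleftrightarrow> a \<le> b"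
| "LFin a \<le> LOmega \<longleftrightarrow> True"
| "LOmega \<le> LOmega \<longleftrightarrow> True"
| "x \<le> LPInf \<longleftrightarrow> True"
| "LOmega \<le> LFin b \<longleftrightarrow> False"
| "LPInf \<le> LFin b \<longleftrightarrow> False"
| "LPInf \<le> LOmega \<longleftrightarrow> False"

definition less_lsr :: "lsr \<Rightarrow> lsr \<Rightarrow> bool" where
  "x < y \<longleftrightarrow> x \<le> y \<and> \<not> y \<le> (x :: lsr)"

instance
proof
  fix x y z :: lsr
  show "x < y \<longleftrightarrow> x \<le> y \<and> \<not> y \<le> x" by (rule less_lsr_def)
  show "x \<le> x" by (cases x) auto
  show "x \<le> y \<Longrightarrow> y \<le> z \<Longrightarrow> x \<le> z" by (cases x; cases y; cases z) auto
  show "x \<le> y \<Longrightarrow> y \<le> x \<Longrightarrow> x = y" by (cases x; cases y) auto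
  show "x \<le> y \<or> y \<le> x" by (cases x; cases y) auto
qed

end

instantiation lsr :: comm_semiring_1
begin

definition zero_lsr :: lsr where "0 = LPInf"

definition one_lsr :: lsr where "1 = LFin 0"

definition plus_lsr :: "lsr \<Rightarrow> lsr \<Rightarrow> lsr" where "x + y = min x (y :: lsr)"

fun times_lsr :: "lsr \<Rightarrow> lsr \<Rightarrow> lsr" where
  "LFin a * LFin b = LFin (a + b)"
| "LOmega * y = max y LOmega"
| "x * LOmega = max x LOmega"
| "LPInf * y = LPInf"
| "x * LPInf = LPInf"

instance
proof
  fix x y z :: lsr
  show "x * y * z = x * (y * z)" by (cases x; cases y; cases z) (auto simp: max_def)
  show "x * y = y * x" by (cases x; cases y) (auto simp: max_def)
  show "1 * x = x" by (cases x) (auto simp: one_lsr_def max_def)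
  show "x + y + z = x + (y + z)" by (simp add: plus_lsr_def min.assoc)
  show "x + y = y + x" by (simp add: plus_lsr_def min.commute)
  show "0 + x = x" by (cases x) (auto simp: plus_lsr_def zero_lsr_def min_def)
  show "0 * x = 0" by (cases x) (auto simp: zero_lsr_def max_def)
  show "x * 0 = 0" by (cases x) (auto simp: zero_lsr_def max_def)
  show "(x + y) * z = x * z + y * z"
    by (cases x; cases y; cases z) (auto simp: plus_lsr_def min_def max_def)
  show "(0 :: lsr) \<noteq> 1" by (simp add: zero_lsr_def one_lsr_def)
qed

end


section \<open>Reachability\<close>

definition mat_prod :: "nat \<Rightarrow> 'a :: semiring_1 mat list \<Rightarrow> 'a mat" where
  "mat_prod n Bs = foldr (*) Bs (1\<^sub>m n)"

text \<open>Nonempty index sequences, numbered from 0.\<close>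

definition index_words :: "nat \<Rightarrow> nat list set" where
  "index_words r = {w. w \<noteq> [] \<and> set w \<subseteq> {..<r}}"

definition matrix_reachable :: "nat \<Rightarrow> 'a :: semiring_1 mat list \<Rightarrow> 'a mat \<Rightarrow> bool" where
  "matrix_reachable n As M \<longleftrightarrow>
    (\<exists>w \<in> index_words (length As). mat_prod n (map ((!) As) w) = M)"

definition vector_reachable ::
  "nat \<Rightarrow> 'a :: semiring_1 mat list \<Rightarrow> 'a mat \<Rightarrow> 'a mat \<Rightarrow> bool" where
  "vector_reachable n As \<alpha> \<eta> \<longleftrightarrow>
    (\<exists>w \<in> index_words (length As). \<alpha> * mat_prod n (map ((!) As) w) = \<eta>)"

definition scalar_reachable ::
  "nat \<Rightarrow> 'a :: semiring_1 mat list \<Rightarrow> 'a mat \<Rightarrow> 'a mat \<Rightarrow> 'a \<Rightarrow> bool" where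
  "scalar_reachable n As \<alpha> \<beta> \<gamma> \<longleftrightarrow>
    (\<exists>w \<in> index_words (length As). (\<alpha> * mat_prod n (map ((!) As) w) * \<beta>) $$ (0, 0) = \<gamma>)"


section \<open>Codes of instances\<close>

fun enc_nmin :: "nmin \<Rightarrow> nat" where
  "enc_nmin NMin_PInf = 0"
| "enc_nmin (NMin a) = a + 1"

fun enc_nmax :: "nmax \<Rightarrow> nat" where
  "enc_nmax NMax_MInf = 0"
| "enc_nmax (NMax a) = a + 1"

fun enc_nbarmax :: "nbarmax \<Rightarrow> nat" where
  "enc_nbarmax NBarMax_MInf = 0"
| "enc_nbarmax NBarMax_PInf = 1"
| "enc_nbarmax (NBarMax a) = a + 2"

fun enc_lsr :: "lsr \<Rightarrow> nat" where
  "enc_lsr LPInf = 0"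
| "enc_lsr LOmega = 1"
| "enc_lsr (LFin a) = a + 2"

definition enc_nat :: "nat \<Rightarrow> nat" where
  "enc_nat a = a"

definition enc_enat :: "enat \<Rightarrow> nat" where
  "enc_enat x = (case x of enat a \<Rightarrow> a + 1 | \<infinity> \<Rightarrow> 0)"

lemma inj_enc:
  "inj enc_nmin" "inj enc_nmax" "inj enc_nbarmax" "inj enc_lsr" "inj enc_nat" "inj enc_enat"
proof -
  show "inj enc_nmin" by (rule injI, case_tac x; case_tac y) auto
  show "inj enc_nmax" by (rule injI, case_tac x; case_tac y) auto
  show "inj enc_nbarmax" by (rule injI, case_tac x; case_tac y) auto
  show "inj enc_lsr" by (rule injI, case_tac x; case_tac y) auto
  show "inj enc_nat" by (auto simp: inj_def enc_nat_def)
  show "inj enc_enat" by (auto simp: inj_def enc_enat_def split: enat.splits)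
qed

text \<open>The code of a matrix is the code of the list of the codes of its rows.\<close>

definition mat_code :: "('a \<Rightarrow> nat) \<Rightarrow> 'a mat \<Rightarrow> nat" where
  "mat_code e A = list_encode (map (\<lambda>row. list_encode (map e row)) (mat_to_list A))"

lemma mat_code_inj:
  assumes "inj e" "A \<in> carrier_mat m n" "B \<in> carrier_mat m n" "mat_code e A = mat_code e B"
  shows "A = B"
proof -
  have "inj (\<lambda>row. list_encode (map e row))"
    using assms(1) by (auto simp: inj_def list_encode_eq)
  then have "mat_to_list A = mat_to_list B"
    using assms(4) by (simp add: mat_code_def list_encode_eq inj_map_eq_map)
  then show ?thesis
    using assms(2,3) by (intro eq_matI) (auto simp: mat_to_list_def)
qed

definition mats_code :: "('a \<Rightarrow> nat) \<Rightarrow> 'a mat list \<Rightarrow> nat" where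
  "mats_code e As = list_encode (map (mat_code e) As)"

text \<open>
  The decision problems over a semiring whose elements are coded by \<open>e\<close>: the sets of codes of the
  positive instances, where the dimension and the number of generators are part of the instance.
\<close>

definition matrix_reachability :: "('a :: semiring_1 \<Rightarrow> nat) \<Rightarrow> nat set" where
  "matrix_reachability e =
    {prod_encode (mats_code e As, mat_code e M) | n As M.
      set As \<subseteq> carrier_mat n n \<and> M \<in> carrier_mat n n \<and> matrix_reachable n As M}"

definition vector_reachability :: "('a :: semiring_1 \<Rightarrow> nat) \<Rightarrow> nat set" where
  "vector_reachability e =
    {prod_encode (mats_code e As, prod_encode (mat_code e \<alpha>, mat_code e \<eta>)) | n As \<alpha> \<eta>.
      set As \<subseteq> carrier_mat n n \<and> \<alpha> \<in> carrier_mat 1 n \<and> \<eta> \<in> carrier_mat 1 n \<and>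
      vector_reachable n As \<alpha> \<eta>}"

definition scalar_reachability :: "('a :: semiring_1 \<Rightarrow> nat) \<Rightarrow> nat set" where
  "scalar_reachability e =
    {prod_encode (mats_code e As, prod_encode (mat_code e \<alpha>, prod_encode (mat_code e \<beta>, e \<gamma>)))
      | n As \<alpha> \<beta> \<gamma>.
      set As \<subseteq> carrier_mat n n \<and> \<alpha> \<in> carrier_mat 1 n \<and> \<beta> \<in> carrier_mat n 1 \<and>
      scalar_reachable n As \<alpha> \<beta> \<gamma>}"

end

theory Submission
  imports Defs "HOL-Library.More_List"
begin

text \<open>
  All six semirings are residually finite in a strong sense: for every threshold \<open>N\<close>, merging all
  finite elements above the threshold into one class, and keeping the infinite elements apart, is a
  congruence with finitely many classes, in which every small element is alone in its class.
  Hence, once \<open>N\<close> exceeds all entries of the target, a product of generators equals the target if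
  and only if the two agree after truncation at \<open>N\<close>, and the truncated products range over a finite
  set. So reachability of the target becomes reachability in a finite transition system, which
  is decided by saturation: the set of states reached is enlarged until no step leads out of it.

  In terms of the codes of elements the truncation is the same function for all the semirings.
  The infinite elements have the codes 0 and 1 at most, and the codes of the finite elements increase
  with the element, so truncation is \<open>\<lambda>x. min x N\<close>. The locale \<open>coded_semiring\<close> collects
  what has to be known about the codes: the operations on codes are computable, and they respect
  truncation. All three problems ask whether \<open>X * A\<^sub>1 * \<dots> * A\<^sub>k * Y = Z\<close> for some
  generators, where \<open>X\<close> and \<open>Y\<close> may be identity matrices
  (\<open>decidable_list_reachability\<close>).

  Decidability is meant in the sense of Kleene's recursive functions on numbers. To be able to write
  the decision procedure as a functional program, \<open>computable\<close> speaks of functions between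
  types whose elements are numbered bijectively; its closure properties, stated for functions of an
  arbitrary context \<open>x\<close>, decompose a program along its syntax. The general form of the
  saturation argument is \<open>finite_reachability_decidable\<close>.
\<close>

section \<open>Closure properties of recursive functions\<close>

text \<open>
  An \<open>n\<close>-ary recursive function matters only through its values on lists of length \<open>n\<close>.
  Closing under agreement on these lists permits to rewrite under the length assumption.
\<close>

definition rec_fun :: "nat \<Rightarrow> (nat list \<Rightarrow> nat) \<Rightarrow> bool" where
  "rec_fun n F \<longleftrightarrow> (\<exists>f. recursive n f \<and> (\<forall>xs. length xs = n \<longrightarrow> f xs = F xs))"

lemma rec_fun_recursive: "recursive n f \<Longrightarrow> rec_fun n f"
  unfolding rec_fun_def by blast

lemma rec_fun_cong:
  "rec_fun n F \<Longrightarrow> (\<And>xs. length xs = n \<Longrightarrow> F xs = G xs) \<Longrightarrow> rec_fun n G"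
  unfolding rec_fun_def by metis

lemma rec_fun_proj: "i < n \<Longrightarrow> rec_fun n (\<lambda>xs. xs ! i)"
  by (intro rec_fun_recursive recursive.proj)

lemma rec_fun_comp:
  assumes "rec_fun (length gs) F" "\<forall>g\<in>set gs. rec_fun n g"
  shows "rec_fun n (\<lambda>xs. F (map (\<lambda>g. g xs) gs))"
proof -
  obtain f where f: "recursive (length gs) f" "\<And>xs. length xs = length gs \<Longrightarrow> f xs = F xs"
    using assms(1) unfolding rec_fun_def by blast
  obtain r where r: "\<forall>g\<in>set gs. recursive n (r g) \<and> (\<forall>xs. length xs = n \<longrightarrow> r g xs = g xs)"
    using assms(2) unfolding rec_fun_def by metis
  have "recursive n (\<lambda>xs. f (map (\<lambda>g. g xs) (map r gs)))"
    using f(1) r by (intro recursive.comp) auto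
  moreover have "f (map (\<lambda>g. g xs) (map r gs)) = F (map (\<lambda>g. g xs) gs)"
    if "length xs = n" for xs
  proof -
    have "map (\<lambda>g. g xs) (map r gs) = map (\<lambda>g. g xs) gs"
      using r that by simp
    then show ?thesis using f(2)[of "map (\<lambda>g. g xs) (map r gs)"] by (simp del: map_map)
  qed
  ultimately show ?thesis unfolding rec_fun_def by blast
qed

text \<open>
  As predicates of \<open>h\<close> itself, these make \<open>h\<close> a first-order match when composition
  rules are applied; the term \<open>h (xs ! 0)\<close> under a binder is not a higher-order pattern.
\<close>

definition rec_unary :: "(nat \<Rightarrow> nat) \<Rightarrow> bool" where
  "rec_unary h \<longleftrightarrow> rec_fun 1 (\<lambda>xs. h (xs ! 0))"

definition rec_binary :: "(nat \<Rightarrow> nat \<Rightarrow> nat) \<Rightarrow> bool" where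
  "rec_binary h \<longleftrightarrow> rec_fun 2 (\<lambda>xs. h (xs ! 0) (xs ! 1))"

lemma rec_fun_unary:
  assumes "rec_unary h" "rec_fun n a"
  shows "rec_fun n (\<lambda>xs. h (a xs))"
  using rec_fun_comp[of "[a]" "\<lambda>xs. h (xs ! 0)" n] assms by (simp add: rec_unary_def)

lemma rec_fun_binary:
  assumes "rec_binary h" "rec_fun n a" "rec_fun n b"
  shows "rec_fun n (\<lambda>xs. h (a xs) (b xs))"
  using rec_fun_comp[of "[a, b]" "\<lambda>xs. h (xs ! 0) (xs ! 1)" n] assms
  by (simp add: rec_binary_def numeral_2_eq_2)

lemma rec_fun_Suc: "rec_fun n a \<Longrightarrow> rec_fun n (\<lambda>xs. Suc (a xs))"
  using rec_fun_unary[OF _ , of Suc n a] rec_fun_recursive[OF recursive.succ]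
  by (simp add: rec_unary_def)

lemma rec_fun_const: "rec_fun n (\<lambda>xs. c)"
  by (induction c) (simp_all add: rec_fun_Suc rec_fun_recursive recursive.zero)

lemma rec_fun_rec_nat:
  assumes a: "rec_fun n a" and s: "rec_fun (Suc (Suc n)) s"
  shows "rec_fun (Suc n) (\<lambda>xs. rec_nat (a (tl xs)) (\<lambda>k y. s (k # y # tl xs)) (hd xs))"
proof -
  obtain f where f: "recursive n f" "\<And>xs. length xs = n \<Longrightarrow> f xs = a xs"
    using a unfolding rec_fun_def by blast
  obtain g where g: "recursive (Suc (Suc n)) g" "\<And>xs. length xs = Suc (Suc n) \<Longrightarrow> g xs = s xs"
    using s unfolding rec_fun_def by blast
  have "rec_fun (Suc n) (\<lambda>xs. rec_nat (f (tl xs)) (\<lambda>k y. g (k # y # tl xs)) (hd xs))"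
    by (intro rec_fun_recursive recursive.prec f g)
  then show ?thesis
    by (rule rec_fun_cong) (simp add: f(2) g(2))
qed

lemma rec_unary_rec_nat:
  assumes "rec_binary s" shows "rec_unary (rec_nat c s)"
proof -
  have "rec_fun (Suc 0) (\<lambda>xs. rec_nat c (\<lambda>k y. s ((k # y # tl xs) ! 0) ((k # y # tl xs) ! 1)) (hd xs))"
    using assms by (intro rec_fun_rec_nat rec_fun_const) (simp add: rec_binary_def numeral_2_eq_2)
  then show ?thesis
    unfolding rec_unary_def One_nat_def by (rule rec_fun_cong) (auto simp: length_Suc_conv)
qed

lemma rec_binary_rec_nat:
  assumes "rec_unary a" "rec_fun 3 (\<lambda>xs. s (xs ! 0) (xs ! 1) (xs ! 2))"
  shows "rec_binary (\<lambda>i x. rec_nat (a x) (\<lambda>k y. s k y x) i)"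
proof -
  have "rec_fun (Suc 1) (\<lambda>xs. rec_nat (a (tl xs ! 0))
    (\<lambda>k y. s ((k # y # tl xs) ! 0) ((k # y # tl xs) ! 1) ((k # y # tl xs) ! 2)) (hd xs))"
    using assms by (intro rec_fun_rec_nat) (simp_all add: rec_unary_def numeral_3_eq_3)
  then have "rec_fun 2 (\<lambda>xs. rec_nat (a (tl xs ! 0))
    (\<lambda>k y. s ((k # y # tl xs) ! 0) ((k # y # tl xs) ! 1) ((k # y # tl xs) ! 2)) (hd xs))"
    by (simp only: Suc_1)
  then show ?thesis
    unfolding rec_binary_def by (rule rec_fun_cong) (auto simp: length_Suc_conv numeral_2_eq_2)
qed

lemma rec_fun_add:
  assumes "rec_fun n a" "rec_fun n b" shows "rec_fun n (\<lambda>xs. a xs + b xs)"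
proof -
  have "rec_binary (\<lambda>i x. rec_nat x (\<lambda>k y. Suc y) i)"
  proof (rule rec_binary_rec_nat)
    show "rec_unary (\<lambda>x. x)" unfolding rec_unary_def by (rule rec_fun_proj) simp
    show "rec_fun 3 (\<lambda>xs. Suc (xs ! 1))" by (intro rec_fun_Suc rec_fun_proj) simp
  qed
  moreover have "rec_nat x (\<lambda>k y. Suc y) i = i + x" for i x by (induction i) auto
  ultimately have "rec_binary (+)" by simp
  then show ?thesis using assms by (rule rec_fun_binary)
qed

lemma rec_fun_diff:
  assumes "rec_fun n a" "rec_fun n b" shows "rec_fun n (\<lambda>xs. a xs - b xs)"
proof -
  have "rec_unary (rec_nat 0 (\<lambda>k y. k))"
    by (rule rec_unary_rec_nat) (simp add: rec_binary_def rec_fun_proj)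
  moreover have "rec_nat 0 (\<lambda>k y. k) = (\<lambda>i. i - 1)"
  proof
    show "rec_nat 0 (\<lambda>k y. k) i = i - 1" for i by (cases i) auto
  qed
  ultimately have pred: "rec_unary (\<lambda>i. i - 1)" by simp
  have "rec_binary (\<lambda>i x. rec_nat x (\<lambda>k y. y - 1) i)"
  proof (rule rec_binary_rec_nat)
    show "rec_unary (\<lambda>x. x)" unfolding rec_unary_def by (rule rec_fun_proj) simp
    show "rec_fun 3 (\<lambda>xs. xs ! 1 - 1)" by (intro rec_fun_unary[OF pred] rec_fun_proj) simp
  qed
  moreover have "rec_nat x (\<lambda>k y. y - 1) i = x - i" for i x :: nat by (induction i) auto
  ultimately have "rec_binary (\<lambda>i x. x - i)" by simp
  then show ?thesis using assms(2,1) by (rule rec_fun_binary)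
qed

lemma rec_fun_triangle:
  assumes "rec_fun n a" shows "rec_fun n (\<lambda>xs. triangle (a xs))"
proof -
  have "rec_unary (rec_nat 0 (\<lambda>k y. y + Suc k))"
    by (rule rec_unary_rec_nat, unfold rec_binary_def)
      (intro rec_fun_proj rec_fun_add rec_fun_Suc; simp)
  moreover have "rec_nat 0 (\<lambda>k y. y + Suc k) = triangle"
  proof
    show "rec_nat 0 (\<lambda>k y. y + Suc k) i = triangle i" for i by (induction i) auto
  qed
  ultimately have "rec_unary triangle" by simp
  then show ?thesis using assms by (rule rec_fun_unary)
qed

lemma rec_fun_prod_encode:
  assumes "rec_fun n a" "rec_fun n b" shows "rec_fun n (\<lambda>xs. prod_encode (a xs, b xs))"
  unfolding prod_encode_def prod.case by (intro rec_fun_add rec_fun_triangle assms)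

lemma rec_unary_Least:
  assumes f: "rec_binary f" and ex: "\<And>x. \<exists>y. f y x = 0"
  shows "rec_unary (\<lambda>x. LEAST y. f y x = 0)"
proof -
  obtain g where g: "recursive 2 g" "\<And>xs. length xs = 2 \<Longrightarrow> g xs = f (xs ! 0) (xs ! 1)"
    using f unfolding rec_binary_def rec_fun_def by blast
  have "rec_fun 1 (\<lambda>xs. LEAST y. g (y # xs) = 0)"
    using g ex by (intro rec_fun_recursive recursive.mu) (simp_all add: numeral_2_eq_2)
  then show ?thesis
    unfolding rec_unary_def by (rule rec_fun_cong) (simp add: g(2))
qed

text \<open>
  The diagonal of the pair coded by \<open>z\<close> is the least \<open>s\<close> such that the triangle number of
  \<open>Suc s\<close> exceeds \<open>z\<close>; the components are read off from it.
\<close>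

lemma rec_fun_prod_decode:
  assumes "rec_fun n a"
  shows rec_fun_fst: "rec_fun n (\<lambda>xs. fst (prod_decode (a xs)))"
    and rec_fun_snd: "rec_fun n (\<lambda>xs. snd (prod_decode (a xs)))"
proof -
  define diag where "diag z = (LEAST s. Suc z - triangle (Suc s) = 0)" for z
  have z_eq: "z = triangle (k + m) + m" if "prod_decode z = (m, k)" for z m k
    using prod_decode_inverse[of z] that by (simp add: prod_encode_def add.commute)
  have diag: "diag z = k + m" if "prod_decode z = (m, k)" for z m k
  proof -
    note z = z_eq[OF that]
    have mono: "triangle i \<le> triangle j" if "i \<le> j" for i j
      using that by (induction rule: dec_induct) auto
    show ?thesis unfolding diag_def
    proof (rule Least_equality)
      fix s assume "Suc z - triangle (Suc s) = 0"
      then have "\<not> triangle (Suc s) \<le> triangle (k + m)" using z by linarith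
      then have "\<not> Suc s \<le> k + m" using mono by blast
      then show "k + m \<le> s" by simp
    qed (subst z, simp)
  qed
  have r: "rec_unary diag" unfolding diag_def
  proof (rule rec_unary_Least)
    show "\<exists>y. Suc z - triangle (Suc y) = 0" for z
    proof
      have "Suc z \<le> triangle (Suc z)" by simp
      then show "Suc z - triangle (Suc z) = 0" by linarith
    qed
    show "rec_binary (\<lambda>y z. Suc z - triangle (Suc y))" unfolding rec_binary_def
      by (intro rec_fun_diff rec_fun_Suc rec_fun_triangle rec_fun_proj; simp)
  qed
  have f: "fst (prod_decode z) = z - triangle (diag z)" for z
  proof (cases "prod_decode z")
    case (Pair m k)
    then show ?thesis using z_eq[OF Pair] diag[OF Pair] by simp
  qed
  have s: "snd (prod_decode z) = diag z - fst (prod_decode z)" for z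
    by (cases "prod_decode z") (simp add: diag)
  show 1: "rec_fun n (\<lambda>xs. fst (prod_decode (a xs)))"
    unfolding f using assms by (intro rec_fun_diff rec_fun_triangle rec_fun_unary[OF r])
  show "rec_fun n (\<lambda>xs. snd (prod_decode (a xs)))"
    unfolding s using 1 assms by (intro rec_fun_diff rec_fun_unary[OF r])
qed

lemma rec_unary_comp: "rec_unary f \<Longrightarrow> rec_unary g \<Longrightarrow> rec_unary (\<lambda>x. f (g x))"
  unfolding rec_unary_def[of g] rec_unary_def[of "\<lambda>x. f (g x)"] by (rule rec_fun_unary)

lemma rec_unary_ident: "rec_unary (\<lambda>x. x)"
  unfolding rec_unary_def by (rule rec_fun_proj) simp

lemma rec_unary_prod_encode:
  "rec_unary f \<Longrightarrow> rec_unary g \<Longrightarrow> rec_unary (\<lambda>x. prod_encode (f x, g x))"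
  unfolding rec_unary_def by (rule rec_fun_prod_encode)

lemma rec_unary_prod_decode:
  "rec_unary (\<lambda>x. fst (prod_decode x))" "rec_unary (\<lambda>x. snd (prod_decode x))"
  unfolding rec_unary_def by (intro rec_fun_prod_decode rec_fun_proj; simp)+

text \<open>
  Primitive recursion with one parameter. The step receives its three arguments as a single coded
  triple, so that unary functions suffice from here on.
\<close>

lemma rec_unary_rec_nat_param:
  assumes a: "rec_unary a" and m: "rec_unary m" and s: "rec_unary s"
  shows "rec_unary (\<lambda>x. rec_nat (a x) (\<lambda>k y. s (prod_encode (x, prod_encode (k, y)))) (m x))"
proof -
  have "rec_binary (\<lambda>i x. rec_nat (a x) (\<lambda>k y. s (prod_encode (x, prod_encode (k, y)))) i)"
    by (rule rec_binary_rec_nat[OF a])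
      (intro rec_fun_unary[OF s] rec_fun_prod_encode rec_fun_proj; simp)
  then show ?thesis
    using m rec_unary_ident unfolding rec_unary_def by (rule rec_fun_binary)
qed


section \<open>Computable functions on coded types\<close>

text \<open>
  The numbering has to be onto: minimisation is only available when a zero exists for every number
  in the parameter place, and with a bijection every number is the code of a parameter.
  For this reason \<open>bool\<close> is not an instance, and predicates are treated separately below.
\<close>

class coded =
  fixes godel :: "'a \<Rightarrow> nat"
  assumes bij_godel: "bij godel"
begin

definition ungodel :: "nat \<Rightarrow> 'a" where "ungodel = inv_into UNIV godel"

lemma ungodel_godel [simp]: "ungodel (godel x) = x"
  unfolding ungodel_def using bij_godel by (simp add: bij_is_inj)

lemma godel_ungodel [simp]: "godel (ungodel n) = n"
  unfolding ungodel_def using bij_godel by (simp add: bij_is_surj surj_f_inv_f)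

lemma godel_eq_iff [simp]: "godel x = godel y \<longleftrightarrow> x = y"
  using bij_godel by (simp add: bij_is_inj inj_eq)

end

instantiation nat :: coded
begin
definition godel_nat :: "nat \<Rightarrow> nat" where [simp]: "godel_nat n = n"
instance by standard (auto simp: bij_def inj_def surj_def)
end

instantiation prod :: (coded, coded) coded
begin
definition godel_prod :: "'a \<times> 'b \<Rightarrow> nat" where
  "godel_prod p = prod_encode (godel (fst p), godel (snd p))"
instance
proof
  show "bij (godel :: 'a \<times> 'b \<Rightarrow> nat)"
  proof (rule bijI)
    show "inj (godel :: 'a \<times> 'b \<Rightarrow> nat)"
      by (rule injI) (simp add: godel_prod_def prod_eq_iff)
    show "surj (godel :: 'a \<times> 'b \<Rightarrow> nat)"
    proof (rule surjI)
      show "godel (map_prod ungodel ungodel (prod_decode n) :: 'a \<times> 'b) = n" for n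
        by (simp add: godel_prod_def)
    qed
  qed
qed
end

instantiation list :: (coded) coded
begin
definition godel_list :: "'a list \<Rightarrow> nat" where
  "godel_list xs = list_encode (map godel xs)"
instance
proof
  show "bij (godel :: 'a list \<Rightarrow> nat)"
  proof (rule bijI)
    show "inj (godel :: 'a list \<Rightarrow> nat)"
    proof (rule injI)
      fix xs ys :: "'a list" assume "godel xs = godel ys"
      then have "map ungodel (map godel xs) = (map ungodel (map godel ys) :: 'a list)"
        by (simp only: godel_list_def list_encode_eq)
      then show "xs = ys" by (simp add: comp_def)
    qed
    show "surj (godel :: 'a list \<Rightarrow> nat)"
    proof (rule surjI)
      show "godel (map ungodel (list_decode n) :: 'a list) = n" for n
        by (simp add: godel_list_def comp_def)
    qed
  qed
qed
end

lemma godel_Pair: "godel (x, y) = prod_encode (godel x, godel y)"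
  by (simp add: godel_prod_def)

lemma godel_Nil: "godel [] = 0" and
  godel_Cons: "godel (x # xs) = Suc (prod_encode (godel x, godel xs))"
  by (simp_all add: godel_list_def)

definition computable :: "('a :: coded \<Rightarrow> 'b :: coded) \<Rightarrow> bool" where
  "computable f \<longleftrightarrow> rec_unary (\<lambda>n. godel (f (ungodel n)))"

lemma computableI:
  assumes "rec_unary g" "\<And>x. g (godel x) = godel (f x)"
  shows "computable f"
proof -
  have "(\<lambda>n. godel (f (ungodel n))) = g" by (simp flip: assms(2))
  then show ?thesis unfolding computable_def using assms(1) by simp
qed

lemma computable_const: "computable (\<lambda>x. c)"
  unfolding computable_def rec_unary_def by (rule rec_fun_const)

lemma computable_ident: "computable (\<lambda>x. x)"
  by (rule computableI[OF rec_unary_ident]) simp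

lemma computable_comp:
  assumes "computable f" "computable g" shows "computable (\<lambda>x. f (g x))"
  using rec_unary_comp[OF assms[unfolded computable_def]] unfolding computable_def by simp

lemma computable_Pair:
  "computable f \<Longrightarrow> computable g \<Longrightarrow> computable (\<lambda>x. (f x, g x))"
  unfolding computable_def godel_Pair by (rule rec_unary_prod_encode)

lemma computable_fst: "computable f \<Longrightarrow> computable (\<lambda>x. fst (f x))"
  by (rule computable_comp[of fst], rule computableI[OF rec_unary_prod_decode(1)])
    (simp_all add: godel_prod_def)

lemma computable_snd: "computable f \<Longrightarrow> computable (\<lambda>x. snd (f x))"
  by (rule computable_comp[of snd], rule computableI[OF rec_unary_prod_decode(2)])
    (simp_all add: godel_prod_def)

text \<open>
  In the rules below the subterms depend on a context \<open>x\<close>. A subterm that binds further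
  variables is required to be computable in the context extended by their values, which is a nested
  pair; such premises therefore mention the projections.
\<close>

named_theorems computable_intros

lemmas [computable_intros] = computable_const computable_ident computable_Pair
  computable_fst computable_snd

lemma computable_comp2:
  assumes "computable (\<lambda>p. f (fst p) (snd p))" "computable a" "computable b"
  shows "computable (\<lambda>x. f (a x) (b x))"
  using computable_comp[OF assms(1) computable_Pair[OF assms(2,3)]] by simp

lemma computable_comp3:
  assumes "computable (\<lambda>p. f (fst p) (fst (snd p)) (snd (snd p)))"
    "computable a" "computable b" "computable c"
  shows "computable (\<lambda>x. f (a x) (b x) (c x))"
  using computable_comp[OF assms(1) computable_Pair[OF assms(2) computable_Pair[OF assms(3,4)]]]
  by simp

lemma computable_rec_nat [computable_intros]:
  assumes a: "computable a" and s: "computable (\<lambda>p. s (fst p) (fst (snd p)) (snd (snd p)))"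
    and m: "computable m"
  shows "computable (\<lambda>x. rec_nat (a x) (s x) (m x))"
proof -
  define A where "A n = godel (a (ungodel n))" for n
  define M where "M n = godel (m (ungodel n))" for n
  define F where "F p = s (fst p) (fst (snd p)) (snd (snd p))" for p
  define S where "S n = godel (F (ungodel n))" for n
  have rec: "rec_unary A" "rec_unary M" "rec_unary S"
    using a m s by (simp_all add: computable_def A_def[abs_def] M_def[abs_def] S_def[abs_def] F_def)
  show ?thesis
  proof (rule computableI[OF rec_unary_rec_nat_param[OF rec]])
    fix x
    have S: "S (prod_encode (godel x, prod_encode (k, godel y))) = godel (s x k y)" for k y
    proof -
      have "prod_encode (godel x, prod_encode (k, godel y)) = godel (x, k, y)"
        by (simp add: godel_Pair)
      then show ?thesis by (simp add: S_def F_def)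
    qed
    have "rec_nat (godel (a x)) (\<lambda>k y. S (prod_encode (godel x, prod_encode (k, y)))) i
        = godel (rec_nat (a x) (s x) i)" for i
      by (induction i) (simp_all add: S)
    then show "rec_nat (A (godel x)) (\<lambda>k y. S (prod_encode (godel x, prod_encode (k, y))))
        (M (godel x)) = godel (rec_nat (a x) (s x) (m x))"
      by (simp add: A_def M_def)
  qed
qed

lemma computable_case_list [computable_intros]:
  assumes a: "computable a" and s: "computable (\<lambda>p. s (fst p) (fst (snd p)) (snd (snd p)))"
    and xs: "computable xs"
  shows "computable (\<lambda>x. case xs x of [] \<Rightarrow> a x | y # ys \<Rightarrow> s x y ys)"
proof -
  define A where "A n = godel (a (ungodel n))" for n
  define M where "M n = godel (xs (ungodel n))" for n
  define F where "F p = s (fst p) (fst (snd p)) (snd (snd p))" for p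
  define S where "S n = godel (F (ungodel n))" for n
  have rec: "rec_unary A" "rec_unary M" "rec_unary S"
    using a xs s by (simp_all add: computable_def A_def[abs_def] M_def[abs_def] S_def[abs_def] F_def)
  \<comment> \<open>A recursion that ignores its accumulator: it sees the predecessor of the code of a
    nonempty list, which codes the head and the tail.\<close>
  define S' where "S' z = S (prod_encode (fst (prod_decode z), fst (prod_decode (snd (prod_decode z)))))" for z
  have S': "rec_unary S'"
    unfolding S'_def[abs_def]
    by (intro rec_unary_comp[OF rec(3)] rec_unary_prod_encode rec_unary_prod_decode
        rec_unary_comp[OF rec_unary_prod_decode(1)])
  show ?thesis
  proof (rule computableI[OF rec_unary_rec_nat_param[OF rec(1,2) S']])
    fix x
    have S: "S (prod_encode (godel x, prod_encode (godel y, godel ys))) = godel (s x y ys)" for y ys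
    proof -
      have "prod_encode (godel x, prod_encode (godel y, godel ys)) = godel (x, y, ys)"
        by (simp add: godel_Pair)
      then show ?thesis by (simp add: S_def F_def)
    qed
    show "rec_nat (A (godel x)) (\<lambda>k y. S' (prod_encode (godel x, prod_encode (k, y))))
        (M (godel x)) = godel (case xs x of [] \<Rightarrow> a x | y # ys \<Rightarrow> s x y ys)"
      by (cases "xs x") (simp_all add: A_def M_def S'_def S godel_Nil godel_Cons)
  qed
qed

lemma computable_Suc [computable_intros]:
  "computable a \<Longrightarrow> computable (\<lambda>x. Suc (a x))"
  unfolding computable_def rec_unary_def by (simp add: rec_fun_Suc)

lemma computable_add [computable_intros]:
  "computable a \<Longrightarrow> computable b \<Longrightarrow> computable (\<lambda>x. a x + b x :: nat)"
  unfolding computable_def rec_unary_def by (simp add: rec_fun_add)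

lemma computable_diff [computable_intros]:
  "computable a \<Longrightarrow> computable b \<Longrightarrow> computable (\<lambda>x. a x - b x :: nat)"
  unfolding computable_def rec_unary_def by (simp add: rec_fun_diff)

lemma computable_mult [computable_intros]:
  assumes "computable a" "computable b" shows "computable (\<lambda>x. a x * b x :: nat)"
proof -
  have "computable (\<lambda>p. rec_nat 0 (\<lambda>k y. y + snd p) (fst p) :: nat)"
    by (intro computable_intros)
  moreover have "rec_nat 0 (\<lambda>k y. y + n) m = m * n" for m n :: nat by (induction m) auto
  ultimately have "computable (\<lambda>p. fst p * snd p :: nat)" by simp
  then show ?thesis using assms by (rule computable_comp2)
qed

lemma computable_godel [computable_intros]: "computable a \<Longrightarrow> computable (\<lambda>x. godel (a x))"
  unfolding computable_def by simp


subsection \<open>Decidable predicates\<close>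

definition decidable_pred :: "('a :: coded \<Rightarrow> bool) \<Rightarrow> bool" where
  "decidable_pred P \<longleftrightarrow> computable (\<lambda>x. of_bool (P x) :: nat)"

lemma decidable_iff_decidable_pred: "decidable S \<longleftrightarrow> decidable_pred (\<lambda>x :: nat. x \<in> S)"
proof -
  have ungodel: "ungodel n = n" for n :: nat
    using godel_ungodel[of n, where 'a = nat] by (simp only: godel_nat_def)
  have "length xs = 1 \<longleftrightarrow> (\<exists>x. xs = [x])" for xs :: "nat list" by (auto simp: length_Suc_conv)
  then show ?thesis
    unfolding decidable_def decidable_pred_def computable_def rec_unary_def rec_fun_def
    by (auto simp: ungodel of_bool_def)
qed

lemma decidable_pred_comp2:
  assumes "decidable_pred (\<lambda>p. P (fst p) (snd p))" "computable a" "computable b"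
  shows "decidable_pred (\<lambda>x. P (a x) (b x))"
  using computable_comp2[of "\<lambda>x y. of_bool (P x y) :: nat", OF _ assms(2,3)] assms(1)
  unfolding decidable_pred_def by simp

lemma computable_if [computable_intros]:
  assumes P: "decidable_pred P" and a: "computable a" and b: "computable b"
  shows "computable (\<lambda>x. if P x then a x else b x)"
proof -
  have "computable (\<lambda>x. rec_nat (b x) (\<lambda>k y. a x) (of_bool (P x)))"
    by (intro computable_rec_nat b P[unfolded decidable_pred_def] computable_comp[OF a]
        computable_intros)
  then show ?thesis by (rule back_subst[of computable]) (auto simp: fun_eq_iff)
qed

lemma decidable_pred_not [computable_intros]:
  assumes "decidable_pred P" shows "decidable_pred (\<lambda>x. \<not> P x)"
proof -
  have "computable (\<lambda>x. 1 - of_bool (P x) :: nat)"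
    using assms unfolding decidable_pred_def by (intro computable_intros)
  then show ?thesis
    unfolding decidable_pred_def by (rule back_subst[of computable]) (auto simp: fun_eq_iff)
qed

lemma decidable_pred_conj [computable_intros]:
  assumes "decidable_pred P" "decidable_pred Q" shows "decidable_pred (\<lambda>x. P x \<and> Q x)"
  using computable_mult[OF assms[unfolded decidable_pred_def]]
  unfolding decidable_pred_def by (simp add: of_bool_conj)

lemma decidable_pred_disj [computable_intros]:
  assumes "decidable_pred P" "decidable_pred Q" shows "decidable_pred (\<lambda>x. P x \<or> Q x)"
  using decidable_pred_not[OF decidable_pred_conj[OF assms[THEN decidable_pred_not]]] by simp

lemma decidable_pred_le [computable_intros]:
  assumes "computable a" "computable b" shows "decidable_pred (\<lambda>x. a x \<le> (b x :: nat))"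
proof -
  have "computable (\<lambda>x. 1 - (a x - b x))"
    by (intro computable_intros assms)
  then show ?thesis
    unfolding decidable_pred_def by (rule back_subst[of computable]) (auto simp: fun_eq_iff)
qed

lemma decidable_pred_eq [computable_intros]:
  assumes "computable a" "computable b" shows "decidable_pred (\<lambda>x. a x = b x)"
proof -
  have "decidable_pred (\<lambda>x. godel (a x) \<le> godel (b x) \<and> godel (b x) \<le> godel (a x))"
    by (intro computable_intros assms)
  then show ?thesis by (simp flip: eq_iff)
qed

lemma computable_min [computable_intros]:
  "computable a \<Longrightarrow> computable b \<Longrightarrow> computable (\<lambda>x. min (a x) (b x :: nat))"
  unfolding min_def by (intro computable_intros)

lemma computable_max [computable_intros]:
  "computable a \<Longrightarrow> computable b \<Longrightarrow> computable (\<lambda>x. max (a x) (b x :: nat))"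
  unfolding max_def by (intro computable_intros)

text \<open>
  Minimisation runs over pairs of a number \<open>k\<close> and a number in the place of \<open>x\<close>.
  As \<open>ungodel\<close> turns the latter into an element of the type, a witness exists for it.
\<close>

lemma computable_Least:
  assumes P: "decidable_pred (\<lambda>p. P (fst p) (snd p))" and ex: "\<And>x. \<exists>k :: nat. P x k"
  shows "computable (\<lambda>x. LEAST k. P x k)"
proof -
  define F where "F p = (1 - of_bool (P (fst p) (snd p)) :: nat)" for p
  have F: "rec_unary (\<lambda>n. F (ungodel n))"
    using computable_diff[OF computable_const P[unfolded decidable_pred_def], of 1]
    by (simp add: computable_def F_def)
  have "rec_binary (\<lambda>k n. F (ungodel (prod_encode (n, k))))"
    unfolding rec_binary_def
    by (intro rec_fun_unary[OF F] rec_fun_prod_encode rec_fun_proj; simp)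
  moreover have dec: "F (ungodel (prod_encode (n, k))) = 1 - of_bool (P (ungodel n) k)" for k n
  proof -
    have "prod_encode (n, k) = godel (ungodel n :: 'a, k)" by (simp add: godel_Pair)
    then show ?thesis by (simp add: F_def)
  qed
  ultimately have "rec_unary (\<lambda>n. LEAST k. (1 - of_bool (P (ungodel n) k) :: nat) = 0)"
    using ex by (intro rec_unary_Least) simp_all
  moreover have "(1 - of_bool Q :: nat) = 0 \<longleftrightarrow> Q" for Q by (cases Q) auto
  ultimately show ?thesis unfolding computable_def by (simp only: godel_nat_def)
qed


subsection \<open>List functions\<close>

lemma computable_Cons [computable_intros]:
  assumes "computable a" "computable b" shows "computable (\<lambda>x. a x # b x)"
  using assms unfolding computable_def rec_unary_def
  by (simp add: godel_Cons rec_fun_Suc rec_fun_prod_encode)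

text \<open>
  The loop consumes one element in each round. The code of a list is at least its length, so it
  is a number of rounds that suffices; surplus rounds change nothing.
\<close>

lemma computable_foldl [computable_intros]:
  assumes f: "computable (\<lambda>p. f (fst p) (fst (snd p)) (snd (snd p)))"
    and a: "computable a" and xs: "computable xs"
  shows "computable (\<lambda>x. foldl (f x) (a x) (xs x))"
proof -
  define step where
    "step x s = (case snd s of [] \<Rightarrow> s | y # ys \<Rightarrow> (f x (fst s) y, ys))" for x s
  have f': "computable (\<lambda>p. f (u p) (v p) (w p))"
    if "computable u" "computable v" "computable w" for u v w
    using f that by (rule computable_comp3)
  have "computable (\<lambda>p. step (fst p) (snd p))"
    unfolding step_def by (intro computable_intros f')
  then have step: "computable (\<lambda>p. step (u p) (v p))" if "computable u" "computable v" for u v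
    using that by (rule computable_comp2)
  have "computable (\<lambda>x. fst (rec_nat (a x, xs x) (\<lambda>k. step x) (godel (xs x))))"
    by (intro computable_intros step a xs)
  moreover have "fst (rec_nat (b, ys) (\<lambda>k. step x) (godel ys)) = foldl (f x) b ys" for x b ys
  proof -
    have "rec_nat (b, ys) (\<lambda>k. step x) i = (foldl (f x) b (take i ys), drop i ys)" for i
    proof (induction i)
      case (Suc i)
      show ?case
      proof (cases "i < length ys")
        case True
        then show ?thesis
          using Suc by (simp add: step_def take_Suc_conv_app_nth flip: Cons_nth_drop_Suc)
      qed (use Suc in \<open>simp add: step_def\<close>)
    qed simp
    moreover have "length ys \<le> godel ys"
    proof (induction ys)
      case (Cons y ys)
      then show ?case
        using le_prod_encode_2[of "godel ys" "godel y"] by (simp add: godel_Cons)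
    qed simp
    ultimately show ?thesis by simp
  qed
  ultimately show ?thesis by simp
qed

lemma computable_rev [computable_intros]:
  assumes "computable a" shows "computable (\<lambda>x. rev (a x))"
proof -
  have "computable (\<lambda>x. foldl (\<lambda>ys y. y # ys) [] (a x))" by (intro computable_intros assms)
  moreover have "foldl (\<lambda>ys y. y # ys) zs xs = rev xs @ zs" for zs xs :: "'b list"
    by (induction xs arbitrary: zs) auto
  ultimately show ?thesis by simp
qed

lemma computable_foldr [computable_intros]:
  assumes f: "computable (\<lambda>p. f (fst p) (fst (snd p)) (snd (snd p)))"
    and a: "computable a" and xs: "computable xs"
  shows "computable (\<lambda>x. foldr (f x) (xs x) (a x))"
  unfolding foldr_conv_foldl by (intro computable_intros computable_comp3[OF f] a xs)

lemma computable_append [computable_intros]: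
  assumes "computable a" "computable b" shows "computable (\<lambda>x. a x @ b x)"
proof -
  have "computable (\<lambda>x. foldr (\<lambda>y ys. y # ys) (a x) (b x))" by (intro computable_intros assms)
  moreover have "foldr (\<lambda>y ys. y # ys) xs ys = xs @ ys" for xs ys :: "'b list"
    by (induction xs) auto
  ultimately show ?thesis by simp
qed

lemma computable_concat [computable_intros]:
  assumes "computable a" shows "computable (\<lambda>x. concat (a x))"
proof -
  have "computable (\<lambda>x. foldr (\<lambda>y ys. y @ ys) (a x) [])" by (intro computable_intros assms)
  then show ?thesis by (simp add: concat_conv_foldr)
qed

lemma computable_map [computable_intros]:
  assumes f: "computable (\<lambda>p. f (fst p) (snd p))" and xs: "computable xs"
  shows "computable (\<lambda>x. map (f x) (xs x))"
proof -
  have "computable (\<lambda>x. foldr (\<lambda>y ys. f x y # ys) (xs x) [])"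
    by (intro computable_intros computable_comp2[OF f] xs)
  moreover have "foldr (\<lambda>y ys. f x y # ys) zs [] = map (f x) zs" for x zs
    by (induction zs) auto
  ultimately show ?thesis by simp
qed

lemma computable_length [computable_intros]:
  assumes "computable a" shows "computable (\<lambda>x. length (a x))"
proof -
  have "computable (\<lambda>x. foldr (\<lambda>y n. Suc n) (a x) 0)" by (intro computable_intros assms)
  moreover have "foldr (\<lambda>y n. Suc n) xs 0 = length xs" for xs :: "'b list" by (induction xs) auto
  ultimately show ?thesis by simp
qed

lemma computable_sum_list [computable_intros]:
  assumes "computable a" shows "computable (\<lambda>x. sum_list (a x) :: nat)"
  unfolding sum_list.eq_foldr by (intro computable_intros assms)

lemma computable_upt [computable_intros]:
  assumes "computable a" shows "computable (\<lambda>x. [0..<a x])"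
proof -
  have "computable (\<lambda>x. rec_nat [] (\<lambda>k ks. ks @ [k]) (a x))" by (intro computable_intros assms)
  moreover have "rec_nat [] (\<lambda>k ks. ks @ [k]) n = [0..<n]" for n by (induction n) auto
  ultimately show ?thesis by simp
qed

text \<open>
  The total variant of indexing is used, because \<open>xs ! i\<close> has an unspecified value beyond the
  end of the list.
\<close>

lemma computable_nth_default [computable_intros]:
  assumes "computable d" "computable xs" "computable i"
  shows "computable (\<lambda>x. nth_default (d x) (xs x) (i x))"
proof -
  have "computable (\<lambda>x. case rec_nat (xs x) (\<lambda>k ys. case ys of [] \<Rightarrow> [] | z # zs \<Rightarrow> zs) (i x) of
      [] \<Rightarrow> d x | y # ys \<Rightarrow> y)"
    by (intro computable_intros assms computable_comp[OF assms(1)])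
  moreover have "rec_nat ys (\<lambda>k ys. case ys of [] \<Rightarrow> [] | z # zs \<Rightarrow> zs) n = drop n ys"
    for ys :: "'b list" and n
    by (induction n) (auto simp: drop_Suc drop_tl split: list.splits simp flip: tl_def)
  moreover have "(case drop n ys of [] \<Rightarrow> e | y # ys \<Rightarrow> y) = nth_default e ys n"
    for ys :: "'b list" and n e
    by (induction ys arbitrary: n) (auto simp: nth_default_Cons drop_Cons split: nat.splits)
  ultimately show ?thesis by simp
qed

lemma decidable_pred_Ball_set [computable_intros]:
  assumes P: "decidable_pred (\<lambda>p. P (fst p) (snd p))" and xs: "computable xs"
  shows "decidable_pred (\<lambda>x. \<forall>y\<in>set (xs x). P x y)"
proof -
  have P': "computable (\<lambda>p. of_bool (P (u p) (v p)) :: nat)" if "computable u" "computable v" for u v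
    using decidable_pred_comp2[OF P that] unfolding decidable_pred_def .
  have "computable (\<lambda>x. foldr (\<lambda>y b. of_bool (P x y) * b) (xs x) (1 :: nat))"
    by (intro computable_intros P' xs)
  moreover have "foldr (\<lambda>y b. of_bool (P x y) * b) zs 1 = (of_bool (\<forall>y\<in>set zs. P x y) :: nat)" for x zs
    by (induction zs) auto
  ultimately show ?thesis unfolding decidable_pred_def by simp
qed

lemma decidable_pred_Bex_set [computable_intros]:
  assumes "decidable_pred (\<lambda>p. P (fst p) (snd p))" and "computable xs"
  shows "decidable_pred (\<lambda>x. \<exists>y\<in>set (xs x). P x y)"
  using decidable_pred_not[OF decidable_pred_Ball_set[OF decidable_pred_not[OF assms(1)] assms(2)]]
  by simp


section \<open>Reachability in finite transition systems\<close>

text \<open>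
  The states reached by nonempty words of length at most \<open>Suc t\<close> form an increasing
  chain of finite sets. As there are finitely many reachable states, the chain cannot grow forever,
  so the search for a \<open>t\<close> whose layer is closed under all steps terminates; finiteness
  alone guarantees this, without a computable bound on the number of states. A closed layer contains
  all reachable states, and it remains to look for a goal in it.
\<close>

lemma finite_reachability_decidable:
  fixes start :: "'x :: coded \<Rightarrow> 's :: coded" and act :: "'x \<Rightarrow> 's \<Rightarrow> 'g :: coded \<Rightarrow> 's"
  assumes start: "computable start" and gens: "computable gens"
    and act: "computable (\<lambda>p. act (fst p) (fst (snd p)) (snd (snd p)))"
    and goal: "decidable_pred (\<lambda>p. goal (fst p) (snd p))"
    and fin: "\<And>x. finite {foldl (act x) (start x) w | w. set w \<subseteq> set (gens x)}"
  shows "decidable_pred (\<lambda>x. \<exists>w. w \<noteq> [] \<and> set w \<subseteq> set (gens x) \<and>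
    goal x (foldl (act x) (start x) w))"
proof -
  define succs where "succs x cs = concat (map (\<lambda>c. map (act x c) (gens x)) cs)" for x cs
  define layer where "layer x t = rec_nat (succs x [start x]) (\<lambda>_ cs. cs @ succs x cs) t" for x t
  \<comment> \<open>Inclusion of sets, spelled out with the quantifiers that have decidability rules.\<close>
  define closed where "closed x t \<longleftrightarrow> (\<forall>c\<in>set (succs x (layer x t)). \<exists>d\<in>set (layer x t). d = c)" for x t
  have "computable (\<lambda>p. succs (fst p) (snd p))"
    unfolding succs_def
    by (intro computable_intros computable_comp3[OF act] computable_comp[OF gens])
  note succs = computable_comp2[OF this]
  have "computable (\<lambda>p. layer (fst p) (snd p))"
    unfolding layer_def by (intro computable_intros succs computable_comp[OF start])
  note layer = computable_comp2[OF this]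
  have closed: "decidable_pred (\<lambda>p. closed (fst p) (snd p))"
    unfolding closed_def by (intro computable_intros layer succs)
  have set_succs: "set (succs x cs) = {act x c g | c g. c \<in> set cs \<and> g \<in> set (gens x)}" for x cs
    by (auto simp: succs_def)
  have layer_0: "layer x 0 = succs x [start x]"
    and layer_Suc: "layer x (Suc t) = layer x t @ succs x (layer x t)" for x t
    by (simp_all add: layer_def)
  define R where "R x = {foldl (act x) (start x) w | w. w \<noteq> [] \<and> set w \<subseteq> set (gens x)}" for x
  have R_step: "act x c g \<in> R x" if "c = start x \<or> c \<in> R x" "g \<in> set (gens x)" for x c g
  proof -
    from that(1) have "\<exists>w. c = foldl (act x) (start x) w \<and> set w \<subseteq> set (gens x)"
    proof
      assume "c = start x"
      then show ?thesis by (intro exI[of _ "[]"]) simp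
    qed (auto simp: R_def)
    then obtain w where "c = foldl (act x) (start x) w" "set w \<subseteq> set (gens x)" by blast
    then show ?thesis
      using that(2) unfolding R_def by (intro CollectI exI[of _ "w @ [g]"]) simp
  qed
  have layer_R: "set (layer x t) \<subseteq> R x" for x t
  proof (induction t)
    case 0
    show ?case using R_step by (auto simp: layer_0 set_succs)
  next
    case (Suc t)
    then have "set (succs x (layer x t)) \<subseteq> R x" using R_step by (auto simp: set_succs)
    with Suc show ?case by (simp add: layer_Suc)
  qed
  have layer_mono: "set (layer x s) \<subseteq> set (layer x t)" if "s \<le> t" for x s t
    using that by (induction rule: dec_induct) (auto simp: layer_Suc)
  have R_layer: "R x = set (layer x t)" if "closed x t" for x t
  proof
    have "foldl (act x) (start x) w \<in> set (layer x t)" if "w \<noteq> []" "set w \<subseteq> set (gens x)" for w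
      using that
    proof (induction w rule: rev_induct)
      case (snoc g w)
      show ?case
      proof (cases "w = []")
        case True
        then have "foldl (act x) (start x) (w @ [g]) \<in> set (layer x 0)"
          using snoc.prems by (auto simp: layer_0 set_succs)
        then show ?thesis using layer_mono[of 0 t x] by auto
      next
        case False
        then have "foldl (act x) (start x) (w @ [g]) \<in> set (succs x (layer x t))"
          using snoc by (auto simp: set_succs)
        then show ?thesis using \<open>closed x t\<close> unfolding closed_def by auto
      qed
    qed simp
    then show "R x \<subseteq> set (layer x t)" unfolding R_def by blast
  qed (rule layer_R)
  have ex_closed: "\<exists>t. closed x t" for x
  proof (rule ccontr)
    assume not_closed: "\<nexists>t. closed x t"
    have "R x \<subseteq> {foldl (act x) (start x) w | w. set w \<subseteq> set (gens x)}" unfolding R_def by blast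
    then have finR: "finite (R x)" using fin finite_subset by blast
    \<comment> \<open>Every layer that is not closed is followed by a strictly larger one.\<close>
    have "t \<le> card (set (layer x t))" for t
    proof (induction t)
      case (Suc t)
      obtain c where "c \<in> set (succs x (layer x t))" "c \<notin> set (layer x t)"
        using not_closed unfolding closed_def by blast
      then have "set (layer x t) \<subset> set (layer x (Suc t))" by (auto simp: layer_Suc)
      then have "card (set (layer x t)) < card (set (layer x (Suc t)))"
        by (intro psubset_card_mono) auto
      with Suc show ?case by simp
    qed simp
    from this[of "Suc (card (R x))"] show False
      using card_mono[OF finR layer_R[of x "Suc (card (R x))"]] by simp
  qed
  have "computable (\<lambda>x. LEAST t. closed x t)"
    by (rule computable_Least[OF closed ex_closed])
  then have "decidable_pred (\<lambda>x. \<exists>c\<in>set (layer x (LEAST t. closed x t)). goal x c)"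
    by (intro computable_intros layer decidable_pred_comp2[OF goal])
  moreover have "(\<exists>c\<in>set (layer x (LEAST t. closed x t)). goal x c) \<longleftrightarrow>
    (\<exists>w. w \<noteq> [] \<and> set w \<subseteq> set (gens x) \<and> goal x (foldl (act x) (start x) w))" for x
  proof -
    have "closed x (LEAST t. closed x t)" by (rule LeastI_ex[of "closed x", OF ex_closed])
    then have "set (layer x (LEAST t. closed x t)) = R x" by (rule R_layer[symmetric])
    then show ?thesis by (auto simp: R_def)
  qed
  ultimately show ?thesis by simp
qed

section \<open>Matrices over a coded semiring\<close>

lemma computable_ungodel [computable_intros]: "computable a \<Longrightarrow> computable (\<lambda>x. ungodel (a x))"
  unfolding computable_def by simp

definition is_matrix :: "nat \<Rightarrow> nat \<Rightarrow> 'a list list \<Rightarrow> bool" where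
  "is_matrix n m X \<longleftrightarrow> length X = n \<and> (\<forall>r\<in>set X. length r = m)"

lemma decidable_pred_is_matrix [computable_intros]:
  assumes "computable n" "computable m" "computable X"
  shows "decidable_pred (\<lambda>x. is_matrix (n x) (m x) (X x :: 'a :: coded list list))"
  unfolding is_matrix_def by (intro computable_intros computable_comp[OF assms(2)] assms)

definition truncate :: "nat \<Rightarrow> nat list list \<Rightarrow> nat list list" where
  "truncate N = map (map (\<lambda>x. min x N))"

lemma computable_truncate [computable_intros]:
  assumes "computable a" "computable b" shows "computable (\<lambda>x. truncate (a x) (b x))"
  unfolding truncate_def
  by (intro computable_intros computable_comp[OF assms(1)] computable_comp[OF assms(2)] assms)

text \<open>
  The threshold exceeds every entry of \<open>Z\<close>, so no entry of \<open>Z\<close> is merged with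
  another number. The sum of the entries serves as an easily computed bound.
\<close>

lemma truncate_eq_truncate_iff:
  assumes "sum_list (map sum_list Z) < N"
  shows "truncate N X = truncate N Z \<longleftrightarrow> X = Z"
proof -
  have "z < N" if "r \<in> set Z" "z \<in> set r" for r z
  proof -
    have "z \<le> sum_list r" using that(2) by (intro member_le_sum_list) simp_all
    also have "\<dots> \<le> sum_list (map sum_list Z)" using that(1) by (intro member_le_sum_list) simp_all
    finally show ?thesis using assms by simp
  qed
  then have "truncate N X = truncate N Z \<Longrightarrow> X = Z"
  proof (induction Z arbitrary: X)
    case (Cons r Z)
    then obtain r' X' where X: "X = r' # X'"
      and r': "map (\<lambda>x. min x N) r' = map (\<lambda>x. min x N) r" and X': "truncate N X' = truncate N Z"
      by (auto simp: truncate_def Cons_eq_map_conv map_eq_Cons_conv)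
    have "\<forall>z\<in>set r. z < N" using Cons.prems(2) by (meson list.set_intros(1))
    with r' have "r' = r"
    proof (induction r arbitrary: r')
      case (Cons z r)
      then show ?case by (cases r') (auto simp: min_def split: if_splits)
    qed simp
    moreover have "X' = Z" using Cons.IH[OF X'] Cons.prems(2) by (meson list.set_intros(2))
    ultimately show ?case using X by simp
  qed (simp add: truncate_def)
  then show ?thesis by blast
qed

lemma finite_matrices: "finite {X. is_matrix n m X \<and> (\<forall>r\<in>set X. set r \<subseteq> {..N :: nat})}"
proof -
  have "finite {X. set X \<subseteq> {r. set r \<subseteq> {..N} \<and> length r = m} \<and> length X = n}"
    by (intro finite_lists_length_eq) simp
  then show ?thesis by (rule rev_finite_subset) (auto simp: is_matrix_def)
qed

lemma set_subset_iff_nths: "set w \<subseteq> set xs \<longleftrightarrow> (\<exists>v. set v \<subseteq> {..<length xs} \<and> w = map ((!) xs) v)"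
proof -
  have "set xs = (!) xs ` {..<length xs}" by (auto simp: set_conv_nth)
  then have "lists (set xs) = map ((!) xs) ` lists {..<length xs}" by (metis lists_image)
  then show ?thesis by (auto simp: lists_eq_set set_eq_iff image_iff)
qed

text \<open>
  The last two assumptions say that truncation is a congruence, in the form in which it acts on a
  product \<open>X * A\<close>: the left factor is the state, which is kept truncated, while \<open>A\<close>
  is a generator. A threshold of at least 3 lies above the codes 0 and 1 of the infinite elements, so
  the class of large elements consists of finite elements only.
\<close>

locale coded_semiring =
  fixes e :: "'a :: semiring_1 \<Rightarrow> nat" and add_code mult_code :: "nat \<Rightarrow> nat \<Rightarrow> nat"
  assumes bij_e: "bij e"
    and e_add: "e (a + b) = add_code (e a) (e b)"
    and e_mult: "e (a * b) = mult_code (e a) (e b)"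
    and computable_add_code: "computable (\<lambda>p. add_code (fst p) (snd p))"
    and computable_mult_code: "computable (\<lambda>p. mult_code (fst p) (snd p))"
    and min_add_code: "3 \<le> N \<Longrightarrow> min (add_code (min x N) (min y N)) N = min (add_code x y) N"
    and min_mult_code: "3 \<le> N \<Longrightarrow> min (mult_code (min x N) y) N = min (mult_code x y) N"
begin

definition sum_code :: "nat list \<Rightarrow> nat" where
  "sum_code xs = foldr add_code xs (e 0)"

text \<open>
  The number \<open>k\<close> of columns of the product is a parameter, since a list of no rows does
  not determine it. The inner dimension is read off the rows of \<open>X\<close>; the product is
  total, whatever the shape of \<open>A\<close>.
\<close>

definition mult_mat :: "nat \<Rightarrow> nat list list \<Rightarrow> nat list list \<Rightarrow> nat list list" where
  "mult_mat k X A = map (\<lambda>r. map (\<lambda>j. sum_code (map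
     (\<lambda>i. mult_code (nth_default 0 r i) (nth_default 0 (nth_default [] A i) j)) [0..<length r]))
     [0..<k]) X"

definition one_code_mat :: "nat \<Rightarrow> nat list list" where
  "one_code_mat n = map (\<lambda>i. map (\<lambda>j. if i = j then e 1 else e 0) [0..<n]) [0..<n]"

lemma computable_mult_mat:
  assumes "computable k" "computable X" "computable A"
  shows "computable (\<lambda>x. mult_mat (k x) (X x) (A x))"
proof -
  have "computable (\<lambda>p. mult_mat (fst p) (fst (snd p)) (snd (snd p)))"
    unfolding mult_mat_def sum_code_def
    by (intro computable_intros computable_comp2[OF computable_add_code]
        computable_comp2[OF computable_mult_code])
  then show ?thesis using assms by (rule computable_comp3)
qed

lemma computable_one_code_mat:
  assumes "computable n" shows "computable (\<lambda>x. one_code_mat (n x))"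
proof -
  have "computable one_code_mat"
    unfolding one_code_mat_def[abs_def] by (intro computable_intros)
  then show ?thesis using assms by (rule computable_comp)
qed

lemma min_sum_code:
  assumes "3 \<le> N" "\<And>i. i \<in> set is \<Longrightarrow> min (f i) N = min (g i) N"
  shows "min (sum_code (map f is)) N = min (sum_code (map g is)) N"
  using assms(2)
proof (induction "is")
  case (Cons i "is")
  have "min (sum_code (map f (i # is))) N
      = min (add_code (min (f i) N) (min (sum_code (map f is)) N)) N"
    by (simp add: sum_code_def min_add_code[OF assms(1)])
  also have "\<dots> = min (add_code (min (g i) N) (min (sum_code (map g is)) N)) N"
    using Cons by simp
  also have "\<dots> = min (sum_code (map g (i # is))) N"
    by (simp add: sum_code_def min_add_code[OF assms(1)])
  finally show ?case .
qed simp

lemma truncate_mult_mat: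
  assumes "3 \<le> N"
  shows "truncate N (mult_mat k (truncate N X) A) = truncate N (mult_mat k X A)"
  unfolding truncate_def mult_mat_def
  by (auto simp: nth_default_nth min_mult_code[OF assms] intro!: min_sum_code[OF assms])

lemma is_matrix_mult_mat: "is_matrix (length X) k (mult_mat k X A)"
  by (auto simp: is_matrix_def mult_mat_def)

text \<open>
  The finite transition system: a state is a truncated matrix, a generator acts by multiplication from
  the right followed by truncation. By \<open>truncate_mult_mat\<close> the state reached by a word is the
  truncation of the product, and by \<open>truncate_eq_truncate_iff\<close> the comparison of
  truncations decides equality with \<open>Z\<close>. After the first step the states have the shape
  given by \<open>n\<close> and the number of rows of \<open>X\<close>, and entries up to the threshold; hence
  there are finitely many of them, even when the lists in the input are no matrices.
\<close>

lemma decidable_list_reachability: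
  fixes n k :: "'x :: coded \<Rightarrow> nat"
  assumes n: "computable n" and k: "computable k" and X: "computable X" and As: "computable As"
    and Y: "computable Y" and Z: "computable Z"
  shows "decidable_pred (\<lambda>x. \<exists>w. w \<noteq> [] \<and> set w \<subseteq> set (As x) \<and>
    mult_mat (k x) (foldl (mult_mat (n x)) (X x) w) (Y x) = Z x)"
proof -
  define N where "N x = 3 + Suc (sum_list (map sum_list (Z x)))" for x
  define start where "start x = truncate (N x) (X x)" for x
  define act where "act x S A = truncate (N x) (mult_mat (n x) S A)" for x S A
  define goal where
    "goal x S \<longleftrightarrow> truncate (N x) (mult_mat (k x) S (Y x)) = truncate (N x) (Z x)" for x S
  have N: "computable N"
    unfolding N_def[abs_def] by (intro computable_intros Z)
  have N3: "3 \<le> N x" for x by (simp add: N_def)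
  have fold: "foldl (act x) (start x) w = truncate (N x) (foldl (mult_mat (n x)) (X x) w)" for x w
    by (induction w rule: rev_induct) (simp_all add: start_def act_def truncate_mult_mat[OF N3])
  have "decidable_pred (\<lambda>x. \<exists>w. w \<noteq> [] \<and> set w \<subseteq> set (As x) \<and>
      goal x (foldl (act x) (start x) w))"
  proof (rule finite_reachability_decidable)
    show "computable start" unfolding start_def[abs_def] by (intro computable_intros N X)
    show "computable As" by (rule As)
    show "computable (\<lambda>p. act (fst p) (fst (snd p)) (snd (snd p)))"
      unfolding act_def
      by (intro computable_truncate computable_mult_mat computable_comp[OF N]
          computable_comp[OF n] computable_intros)
    show "decidable_pred (\<lambda>p. goal (fst p) (snd p))"
      unfolding goal_def
      by (intro decidable_pred_eq computable_truncate computable_mult_mat computable_comp[OF N]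
          computable_comp[OF k] computable_comp[OF Y] computable_comp[OF Z]
          computable_fst computable_snd computable_ident)
    show "finite {foldl (act x) (start x) w | w. set w \<subseteq> set (As x)}" for x
    proof -
      let ?F = "{S. is_matrix (length (X x)) (n x) S \<and> (\<forall>r\<in>set S. set r \<subseteq> {..N x})}"
      have length: "length (foldl (act x) (start x) w) = length (X x)" for w
        by (induction w rule: rev_induct)
          (simp_all add: start_def act_def truncate_def mult_mat_def)
      have "foldl (act x) (start x) w \<in> insert (start x) ?F" for w
      proof (induction w rule: rev_induct)
        case (snoc A w)
        have "is_matrix (length (X x)) (n x) (act x (foldl (act x) (start x) w) A)"
          using is_matrix_mult_mat[of "foldl (act x) (start x) w" "n x" A]
          by (auto simp: length act_def truncate_def is_matrix_def)
        moreover have "\<forall>r\<in>set (act x S A). set r \<subseteq> {..N x}" for S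
          by (auto simp: act_def truncate_def)
        ultimately show ?case by simp
      qed simp
      then have "{foldl (act x) (start x) w | w. set w \<subseteq> set (As x)} \<subseteq> insert (start x) ?F"
        by blast
      then show ?thesis by (rule finite_subset) (simp add: finite_matrices)
    qed
  qed
  moreover have "goal x (foldl (act x) (start x) w) \<longleftrightarrow>
      mult_mat (k x) (foldl (mult_mat (n x)) (X x) w) (Y x) = Z x" for x w
    unfolding goal_def fold truncate_mult_mat[OF N3]
    by (rule truncate_eq_truncate_iff) (simp add: N_def)
  ultimately show ?thesis by simp
qed


subsection \<open>Coded matrices\<close>

definition code_mat :: "'a mat \<Rightarrow> nat list list" where
  "code_mat A = map (map e) (mat_to_list A)"

lemma mat_code_eq_godel: "mat_code e A = godel (code_mat A)"
  by (simp add: mat_code_def code_mat_def godel_list_def comp_def)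

lemma mats_code_eq_godel: "mats_code e As = godel (map code_mat As)"
  by (simp add: mats_code_def mat_code_eq_godel[abs_def] godel_list_def comp_def)

lemma code_mat_inj:
  "A \<in> carrier_mat m n \<Longrightarrow> B \<in> carrier_mat m n \<Longrightarrow> code_mat A = code_mat B \<longleftrightarrow> A = B"
  using mat_code_inj[of e A m n B] bij_e by (auto simp: bij_def mat_code_eq_godel)

lemma is_matrix_code_mat: "A \<in> carrier_mat m n \<Longrightarrow> is_matrix m n (code_mat A)"
  by (auto simp: is_matrix_def code_mat_def mat_to_list_def)

lemma is_matrix_imp_code_mat:
  assumes "is_matrix m n X" shows "\<exists>A\<in>carrier_mat m n. code_mat A = X"
proof
  let ?A = "mat m n (\<lambda>(i, j). inv_into UNIV e (X ! i ! j))"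
  show "?A \<in> carrier_mat m n" by simp
  have "e (inv_into UNIV e c) = c" for c using bij_e by (simp add: bij_is_surj surj_f_inv_f)
  then show "code_mat ?A = X"
    using assms by (auto simp: is_matrix_def code_mat_def mat_to_list_def intro!: nth_equalityI)
qed

lemma code_mat_mult:
  assumes A: "A \<in> carrier_mat m n" and B: "B \<in> carrier_mat n k"
  shows "code_mat (A * B) = mult_mat k (code_mat A) (code_mat B)"
proof -
  have e_sum: "e (sum_list xs) = sum_code (map e xs)" for xs
    by (induction xs) (simp_all add: sum_code_def e_add)
  have "e ((A * B) $$ (i, j)) = sum_code (map (\<lambda>l. mult_code (e (A $$ (i, l))) (e (B $$ (l, j)))) [0..<n])"
    if "i < m" "j < k" for i j
  proof -
    have "(A * B) $$ (i, j) = (\<Sum>l = 0..<n. A $$ (i, l) * B $$ (l, j))"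
      using that A B by (auto simp: scalar_prod_def intro!: sum.cong)
    also have "\<dots> = sum_list (map (\<lambda>l. A $$ (i, l) * B $$ (l, j)) [0..<n])"
      by (simp add: interv_sum_list_conv_sum_set_nat)
    finally show ?thesis by (simp add: e_sum e_mult comp_def)
  qed
  then show ?thesis
    using A B by (auto simp: code_mat_def mult_mat_def mat_to_list_def nth_default_nth comp_def
        cong: map_cong intro!: arg_cong[where f = sum_code])
qed

lemma code_mat_one: "code_mat (1\<^sub>m n) = one_code_mat n"
  by (auto simp: code_mat_def one_code_mat_def mat_to_list_def)

lemma mat_prod_carrier:
  "set Bs \<subseteq> carrier_mat n n \<Longrightarrow> mat_prod n (Bs :: 'a mat list) \<in> carrier_mat n n"
  by (induction Bs) (auto simp: mat_prod_def)

lemma code_mat_mult_mat_prod: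
  assumes "X \<in> carrier_mat m n" "set Bs \<subseteq> carrier_mat n n"
  shows "foldl (mult_mat n) (code_mat X) (map code_mat Bs) = code_mat (X * mat_prod n Bs)"
  using assms
proof (induction Bs arbitrary: X)
  case (Cons B Bs)
  have B: "B \<in> carrier_mat n n" using Cons.prems by simp
  have "foldl (mult_mat n) (code_mat X) (map code_mat (B # Bs)) = code_mat (X * B * mat_prod n Bs)"
    using Cons.IH[of "X * B"] Cons.prems by (simp add: code_mat_mult[OF Cons.prems(1) B])
  also have "X * B * mat_prod n Bs = X * mat_prod n (B # Bs)"
    using assoc_mult_mat[OF Cons.prems(1) B mat_prod_carrier] Cons.prems by (simp add: mat_prod_def)
  finally show ?case .
qed (simp add: mat_prod_def)

text \<open>
  Transfer from lists of codes to matrices over the semiring, and from words over the set of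
  generators to index sequences.
\<close>

lemma list_reachability_iff:
  assumes X: "X \<in> carrier_mat m n" and Bs: "set Bs \<subseteq> carrier_mat n n"
    and Y: "Y \<in> carrier_mat n k" and Z: "Z \<in> carrier_mat m k"
  shows "(\<exists>w. w \<noteq> [] \<and> set w \<subseteq> set (map code_mat Bs) \<and>
      mult_mat k (foldl (mult_mat n) (code_mat X) w) (code_mat Y) = code_mat Z) \<longleftrightarrow>
    (\<exists>w\<in>index_words (length Bs). X * mat_prod n (map ((!) Bs) w) * Y = Z)"
proof -
  have "mult_mat k (foldl (mult_mat n) (code_mat X) (map ((!) (map code_mat Bs)) v)) (code_mat Y)
        = code_mat Z \<longleftrightarrow> X * mat_prod n (map ((!) Bs) v) * Y = Z"
    if "set v \<subseteq> {..<length Bs}" for v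
  proof -
    have Bv: "set (map ((!) Bs) v) \<subseteq> carrier_mat n n"
      using that Bs by (auto simp: subset_iff)
    have XP: "X * mat_prod n (map ((!) Bs) v) \<in> carrier_mat m n"
      using X mat_prod_carrier[OF Bv] by (rule mult_carrier_mat)
    have v: "map ((!) (map code_mat Bs)) v = map code_mat (map ((!) Bs) v)"
      using that by auto
    show ?thesis
      unfolding v code_mat_mult_mat_prod[OF X Bv] code_mat_mult[OF XP Y, symmetric]
      by (rule code_mat_inj[OF mult_carrier_mat[OF XP Y] Z])
  qed
  then show ?thesis
    unfolding set_subset_iff_nths index_words_def by (auto simp del: map_map) 
qed

lemma are_matrices_imp_code_mats:
  assumes "\<forall>X\<in>set Xs. is_matrix n n X"
  shows "\<exists>Bs. set Bs \<subseteq> carrier_mat n n \<and> map code_mat Bs = Xs"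
  using assms
proof (induction Xs)
  case (Cons X Xs)
  then obtain Bs where "set Bs \<subseteq> carrier_mat n n" "map code_mat Bs = Xs" by auto
  moreover obtain B where "B \<in> carrier_mat n n" "code_mat B = X"
    using Cons.prems is_matrix_imp_code_mat[of n n X] by auto
  ultimately show ?case by (intro exI[of _ "B # Bs"]) simp
qed simp


subsection \<open>The three reachability problems\<close>

definition reaches :: "nat \<Rightarrow> nat \<Rightarrow> nat list list \<Rightarrow> nat list list list \<Rightarrow> nat list list \<Rightarrow> nat list list \<Rightarrow> bool" where
  "reaches n k X As Y Z \<longleftrightarrow>
    (\<exists>w. w \<noteq> [] \<and> set w \<subseteq> set As \<and> mult_mat k (foldl (mult_mat n) X w) Y = Z)"

lemmas decidable_reaches = decidable_list_reachability[folded reaches_def]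
lemmas reaches_iff = list_reachability_iff[folded reaches_def]

lemma matrix_reachable_iff_reaches:
  assumes "set Bs \<subseteq> carrier_mat n n" "M \<in> carrier_mat n n"
  shows "matrix_reachable n Bs M \<longleftrightarrow>
    reaches n n (one_code_mat n) (map code_mat Bs) (one_code_mat n) (code_mat M)"
proof -
  have "1\<^sub>m n * mat_prod n (map ((!) Bs) w) * 1\<^sub>m n = mat_prod n (map ((!) Bs) w)"
    if "w \<in> index_words (length Bs)" for w
  proof -
    have "set (map ((!) Bs) w) \<subseteq> carrier_mat n n"
      using that assms(1) by (auto simp: index_words_def subset_iff)
    from mat_prod_carrier[OF this] show ?thesis by simp
  qed
  then show ?thesis
    unfolding matrix_reachable_def code_mat_one[symmetric]
      reaches_iff[OF one_carrier_mat assms(1) one_carrier_mat assms(2)]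
    by (intro bex_cong) simp_all
qed

lemma vector_reachable_iff_reaches:
  assumes "set Bs \<subseteq> carrier_mat n n" "a \<in> carrier_mat 1 n" "b \<in> carrier_mat 1 n"
  shows "vector_reachable n Bs a b \<longleftrightarrow>
    reaches n n (code_mat a) (map code_mat Bs) (one_code_mat n) (code_mat b)"
proof -
  have "a * mat_prod n (map ((!) Bs) w) * 1\<^sub>m n = a * mat_prod n (map ((!) Bs) w)"
    if "w \<in> index_words (length Bs)" for w
  proof -
    have "set (map ((!) Bs) w) \<subseteq> carrier_mat n n"
      using that assms(1) by (auto simp: index_words_def subset_iff)
    from mult_carrier_mat[OF assms(2) mat_prod_carrier[OF this]] show ?thesis
      by (rule right_mult_one_mat)
  qed
  then show ?thesis
    unfolding vector_reachable_def code_mat_one[symmetric]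
      reaches_iff[OF assms(2,1) one_carrier_mat assms(3)]
    by (intro bex_cong) simp_all
qed

text \<open>A scalar is the same as a 1-by-1 matrix, so the scalar problem has a matrix target as well.\<close>

lemma scalar_reachable_iff_reaches:
  assumes "set Bs \<subseteq> carrier_mat n n" "a \<in> carrier_mat 1 n" "b \<in> carrier_mat n 1"
  shows "scalar_reachable n Bs a b c \<longleftrightarrow>
    reaches n 1 (code_mat a) (map code_mat Bs) (code_mat b) [[e c]]"
proof -
  let ?C = "mat 1 1 (\<lambda>_. c)"
  have C: "?C \<in> carrier_mat 1 1" "code_mat ?C = [[e c]]"
    by (simp_all add: code_mat_def mat_to_list_def)
  have "(a * mat_prod n (map ((!) Bs) w) * b) $$ (0, 0) = c \<longleftrightarrow>
      a * mat_prod n (map ((!) Bs) w) * b = ?C" for w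
  proof
    assume "(a * mat_prod n (map ((!) Bs) w) * b) $$ (0, 0) = c"
    then show "a * mat_prod n (map ((!) Bs) w) * b = ?C"
      using assms(2,3) by (intro eq_matI) (simp_all del: index_mult_mat(1))
  qed simp
  then show ?thesis
    unfolding scalar_reachable_def C(2)[symmetric] reaches_iff[OF assms(2,1,3) C(1)]
    by (intro bex_cong) simp_all
qed

text \<open>
  Every number codes some lists; a positive instance is one whose lists have matching dimensions and
  for which \<open>reaches\<close> holds. The dimension is read off the target.
\<close>

lemma decidable_matrix_reachability: "decidable (matrix_reachability e)"
proof -
  define check where "check p \<longleftrightarrow> is_matrix (length (snd p)) (length (snd p)) (snd p) \<and>
      (\<forall>A\<in>set (fst p). is_matrix (length (snd p)) (length (snd p)) A) \<and>
      reaches (length (snd p)) (length (snd p)) (one_code_mat (length (snd p))) (fst p)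
        (one_code_mat (length (snd p))) (snd p)" for p
  have code_in: "godel (Xs, X) \<in> matrix_reachability e \<longleftrightarrow> check (Xs, X)" for Xs X
  proof
    assume "godel (Xs, X) \<in> matrix_reachability e"
    then obtain n Bs M where inst: "Xs = map code_mat Bs" "X = code_mat M"
      and Bs: "set Bs \<subseteq> carrier_mat n n" and M: "M \<in> carrier_mat n n" and "matrix_reachable n Bs M"
      unfolding matrix_reachability_def
      by (auto simp: mats_code_eq_godel mat_code_eq_godel simp flip: godel_Pair)
    moreover have "length X = n" using is_matrix_code_mat[OF M] inst by (simp add: is_matrix_def)
    ultimately show "check (Xs, X)"
      using is_matrix_code_mat[OF M] is_matrix_code_mat[where m = n and n = n]
        matrix_reachable_iff_reaches[OF Bs M] by (auto simp: check_def)
  next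
    assume c: "check (Xs, X)"
    obtain Bs where Bs: "set Bs \<subseteq> carrier_mat (length X) (length X)" "map code_mat Bs = Xs"
      using c are_matrices_imp_code_mats[of Xs] by (auto simp: check_def)
    obtain M where M: "M \<in> carrier_mat (length X) (length X)" "code_mat M = X"
      using c is_matrix_imp_code_mat[of "length X" "length X" X] by (auto simp: check_def)
    have "matrix_reachable (length X) Bs M"
      using c matrix_reachable_iff_reaches[OF Bs(1) M(1)] Bs(2) M(2) by (simp add: check_def)
    moreover have "godel (Xs, X) = prod_encode (mats_code e Bs, mat_code e M)"
      by (simp add: godel_Pair mats_code_eq_godel mat_code_eq_godel Bs M)
    ultimately show "godel (Xs, X) \<in> matrix_reachability e"
      unfolding matrix_reachability_def using Bs(1) M(1) by blast
  qed
  have "godel p \<in> matrix_reachability e \<longleftrightarrow> check p" for p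
    using code_in by (cases p) simp
  from this[of "ungodel _"] have "x \<in> matrix_reachability e \<longleftrightarrow> check (ungodel x)" for x
    by simp
  moreover have "decidable_pred (\<lambda>x :: nat. check (ungodel x))"
    unfolding check_def
    by (intro computable_intros decidable_reaches computable_one_code_mat)
  ultimately show ?thesis unfolding decidable_iff_decidable_pred by simp
qed

text \<open>
  In the other two problems the dimension is the length of the initial row vector. It cannot be taken
  from the generators, because there may be none.
\<close>

lemma length_row_code_mat: "a \<in> carrier_mat 1 n \<Longrightarrow> length (nth_default [] (code_mat a) 0) = n"
  using is_matrix_code_mat[of a 1 n] by (auto simp: is_matrix_def nth_default_def)

lemma decidable_vector_reachability: "decidable (vector_reachability e)"
proof -
  define dim where "dim X = length (nth_default [] X 0)" for X :: "nat list list"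
  define check where "check p \<longleftrightarrow>
      is_matrix 1 (dim (fst (snd p))) (fst (snd p)) \<and> is_matrix 1 (dim (fst (snd p))) (snd (snd p)) \<and>
      (\<forall>A\<in>set (fst p). is_matrix (dim (fst (snd p))) (dim (fst (snd p))) A) \<and>
      reaches (dim (fst (snd p))) (dim (fst (snd p))) (fst (snd p)) (fst p)
        (one_code_mat (dim (fst (snd p)))) (snd (snd p))" for p
  have code_in: "godel (Xs, X, Z) \<in> vector_reachability e \<longleftrightarrow> check (Xs, X, Z)" for Xs X Z
  proof
    assume "godel (Xs, X, Z) \<in> vector_reachability e"
    then obtain n Bs a b where inst: "Xs = map code_mat Bs" "X = code_mat a" "Z = code_mat b"
      and Bs: "set Bs \<subseteq> carrier_mat n n" and a: "a \<in> carrier_mat 1 n" and b: "b \<in> carrier_mat 1 n"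
      and "vector_reachable n Bs a b"
      unfolding vector_reachability_def
      by (auto simp: mats_code_eq_godel mat_code_eq_godel simp flip: godel_Pair)
    moreover have "dim X = n" using length_row_code_mat[OF a] inst by (simp add: dim_def)
    ultimately show "check (Xs, X, Z)"
      using is_matrix_code_mat[OF a] is_matrix_code_mat[OF b] is_matrix_code_mat[where m = n and n = n]
        vector_reachable_iff_reaches[OF Bs a b] by (auto simp: check_def)
  next
    assume c: "check (Xs, X, Z)"
    obtain Bs where Bs: "set Bs \<subseteq> carrier_mat (dim X) (dim X)" "map code_mat Bs = Xs"
      using c are_matrices_imp_code_mats[of Xs] by (auto simp: check_def)
    obtain a where a: "a \<in> carrier_mat 1 (dim X)" "code_mat a = X"
      using c is_matrix_imp_code_mat[of 1 "dim X" X] by (auto simp: check_def)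
    obtain b where b: "b \<in> carrier_mat 1 (dim X)" "code_mat b = Z"
      using c is_matrix_imp_code_mat[of 1 "dim X" Z] by (auto simp: check_def)
    have "vector_reachable (dim X) Bs a b"
      using c vector_reachable_iff_reaches[OF Bs(1) a(1) b(1)] Bs(2) a(2) b(2)
      by (simp add: check_def)
    moreover have "godel (Xs, X, Z) = prod_encode (mats_code e Bs, prod_encode (mat_code e a, mat_code e b))"
      by (simp add: godel_Pair mats_code_eq_godel mat_code_eq_godel Bs a b)
    ultimately show "godel (Xs, X, Z) \<in> vector_reachability e"
      unfolding vector_reachability_def using Bs(1) a(1) b(1) by blast
  qed
  have "godel p \<in> vector_reachability e \<longleftrightarrow> check p" for p
    using code_in by (cases p) simp
  from this[of "ungodel _"] have "x \<in> vector_reachability e \<longleftrightarrow> check (ungodel x)" for x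
    by simp
  moreover have "decidable_pred (\<lambda>x :: nat. check (ungodel x))"
    unfolding check_def dim_def
    by (intro computable_intros decidable_reaches computable_one_code_mat)
  ultimately show ?thesis unfolding decidable_iff_decidable_pred by simp
qed

lemma decidable_scalar_reachability: "decidable (scalar_reachability e)"
proof -
  define dim where "dim X = length (nth_default [] X 0)" for X :: "nat list list"
  define check where "check p \<longleftrightarrow>
      is_matrix 1 (dim (fst (snd p))) (fst (snd p)) \<and>
      is_matrix (dim (fst (snd p))) 1 (fst (snd (snd p))) \<and>
      (\<forall>A\<in>set (fst p). is_matrix (dim (fst (snd p))) (dim (fst (snd p))) A) \<and>
      reaches (dim (fst (snd p))) 1 (fst (snd p)) (fst p) (fst (snd (snd p)))
        [[snd (snd (snd p))]]" for p
  have code_in: "godel (Xs, X, Y, z) \<in> scalar_reachability e \<longleftrightarrow> check (Xs, X, Y, z)" for Xs X Y z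
  proof
    assume "godel (Xs, X, Y, z) \<in> scalar_reachability e"
    then obtain n Bs a b c where inst: "Xs = map code_mat Bs" "X = code_mat a" "Y = code_mat b" "z = e c"
      and Bs: "set Bs \<subseteq> carrier_mat n n" and a: "a \<in> carrier_mat 1 n" and b: "b \<in> carrier_mat n 1"
      and "scalar_reachable n Bs a b c"
      unfolding scalar_reachability_def
      by (auto simp: mats_code_eq_godel mat_code_eq_godel godel_Pair)
    moreover have "dim X = n" using length_row_code_mat[OF a] inst by (simp add: dim_def)
    ultimately show "check (Xs, X, Y, z)"
      using is_matrix_code_mat[OF a] is_matrix_code_mat[OF b] is_matrix_code_mat[where m = n and n = n]
        scalar_reachable_iff_reaches[OF Bs a b] by (auto simp: check_def)
  next
    assume c: "check (Xs, X, Y, z)"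
    obtain Bs where Bs: "set Bs \<subseteq> carrier_mat (dim X) (dim X)" "map code_mat Bs = Xs"
      using c are_matrices_imp_code_mats[of Xs] by (auto simp: check_def)
    obtain a where a: "a \<in> carrier_mat 1 (dim X)" "code_mat a = X"
      using c is_matrix_imp_code_mat[of 1 "dim X" X] by (auto simp: check_def)
    obtain b where b: "b \<in> carrier_mat (dim X) 1" "code_mat b = Y"
      using c is_matrix_imp_code_mat[of "dim X" 1 Y] by (auto simp: check_def)
    obtain c' where c': "e c' = z" using bij_e by (metis bij_pointE)
    have "scalar_reachable (dim X) Bs a b c'"
      using c scalar_reachable_iff_reaches[OF Bs(1) a(1) b(1), of c'] Bs(2) a(2) b(2) c'
      by (simp add: check_def)
    moreover have "godel (Xs, X, Y, z) =
        prod_encode (mats_code e Bs, prod_encode (mat_code e a, prod_encode (mat_code e b, e c')))"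
      by (simp add: godel_Pair mats_code_eq_godel mat_code_eq_godel Bs a b c')
    ultimately show "godel (Xs, X, Y, z) \<in> scalar_reachability e"
      unfolding scalar_reachability_def using Bs(1) a(1) b(1) by blast
  qed
  have "godel p \<in> scalar_reachability e \<longleftrightarrow> check p" for p
    using code_in by (cases p) simp
  from this[of "ungodel _"] have "x \<in> scalar_reachability e \<longleftrightarrow> check (ungodel x)" for x
    by simp
  moreover have "decidable_pred (\<lambda>x :: nat. check (ungodel x))"
    unfolding check_def dim_def
    by (intro computable_intros decidable_reaches)
  ultimately show ?thesis unfolding decidable_iff_decidable_pred by simp
qed

end

section \<open>The six semirings\<close>

text \<open>
  In each case the operations are written out on codes. A finite element \<open>a\<close> has the code
  \<open>a + c\<close>, where \<open>c\<close> is the number of infinite elements, so the tropical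
  product of two finite elements with codes \<open>x\<close> and \<open>y\<close> has the code \<open>x + y - c\<close>.
\<close>

interpretation nmin: coded_semiring enc_nmin
  "\<lambda>x y. if x = 0 then y else if y = 0 then x else min x y"
  "\<lambda>x y. if x = 0 \<or> y = 0 then 0 else x + y - 1"
proof
  show "bij enc_nmin"
  proof (rule bijI[OF inj_enc(1)], rule surjI)
    show "enc_nmin (if n = 0 then NMin_PInf else NMin (n - 1)) = n" for n by simp
  qed
  show "enc_nmin (a + b) = (if enc_nmin a = 0 then enc_nmin b else if enc_nmin b = 0 then enc_nmin a
      else min (enc_nmin a) (enc_nmin b))" for a b
    by (cases a; cases b) (auto simp: plus_nmin_def min_def)
  show "enc_nmin (a * b) = (if enc_nmin a = 0 \<or> enc_nmin b = 0 then 0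
      else enc_nmin a + enc_nmin b - 1)" for a b
    by (cases a; cases b) auto
qed (intro computable_intros | auto simp: min_def)+

interpretation nmax: coded_semiring enc_nmax max
  "\<lambda>x y. if x = 0 \<or> y = 0 then 0 else x + y - 1"
proof
  show "bij enc_nmax"
  proof (rule bijI[OF inj_enc(2)], rule surjI)
    show "enc_nmax (if n = 0 then NMax_MInf else NMax (n - 1)) = n" for n by simp
  qed
  show "enc_nmax (a + b) = max (enc_nmax a) (enc_nmax b)" for a b
    by (cases a; cases b) (auto simp: plus_nmax_def max_def)
  show "enc_nmax (a * b) = (if enc_nmax a = 0 \<or> enc_nmax b = 0 then 0
      else enc_nmax a + enc_nmax b - 1)" for a b
    by (cases a; cases b) auto
qed (intro computable_intros | auto simp: min_def max_def)+

interpretation nbarmax: coded_semiring enc_nbarmax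
  "\<lambda>x y. if x = 1 \<or> y = 1 then 1 else max x y"
  "\<lambda>x y. if x = 0 \<or> y = 0 then 0 else if x = 1 \<or> y = 1 then 1 else x + y - 2"
proof
  show "bij enc_nbarmax"
  proof (rule bijI[OF inj_enc(3)], rule surjI)
    show "enc_nbarmax (if n = 0 then NBarMax_MInf else if n = 1 then NBarMax_PInf
      else NBarMax (n - 2)) = n" for n by auto
  qed
  show "enc_nbarmax (a + b) = (if enc_nbarmax a = 1 \<or> enc_nbarmax b = 1 then 1
      else max (enc_nbarmax a) (enc_nbarmax b))" for a b
    by (cases a; cases b) (auto simp: plus_nbarmax_def max_def)
  show "enc_nbarmax (a * b) = (if enc_nbarmax a = 0 \<or> enc_nbarmax b = 0 then 0
      else if enc_nbarmax a = 1 \<or> enc_nbarmax b = 1 then 1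
      else enc_nbarmax a + enc_nbarmax b - 2)" for a b
    by (cases a; cases b) auto
qed (intro computable_intros | auto simp: min_def max_def)+

interpretation lsr: coded_semiring enc_lsr
  "\<lambda>x y. if x = 0 then y else if y = 0 then x else if x = 1 then y else if y = 1 then x else min x y"
  "\<lambda>x y. if x = 0 \<or> y = 0 then 0 else if x = 1 \<or> y = 1 then 1 else x + y - 2"
proof
  show "bij enc_lsr"
  proof (rule bijI[OF inj_enc(4)], rule surjI)
    show "enc_lsr (if n = 0 then LPInf else if n = 1 then LOmega else LFin (n - 2)) = n" for n by auto
  qed
  show "enc_lsr (a + b) = (if enc_lsr a = 0 then enc_lsr b else if enc_lsr b = 0 then enc_lsr a
      else if enc_lsr a = 1 then enc_lsr b else if enc_lsr b = 1 then enc_lsr a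
      else min (enc_lsr a) (enc_lsr b))" for a b
    by (cases a; cases b) (auto simp: plus_lsr_def min_def)
  show "enc_lsr (a * b) = (if enc_lsr a = 0 \<or> enc_lsr b = 0 then 0
      else if enc_lsr a = 1 \<or> enc_lsr b = 1 then 1 else enc_lsr a + enc_lsr b - 2)" for a b
    by (cases a; cases b) (auto simp: max_def)
qed (intro computable_intros | auto simp: min_def)+

text \<open>
  In the semirings with the usual multiplication, a large factor makes the product large unless the
  other factor is zero.
\<close>

lemma min_mult_min: "min (min x N * y) N = min (x * y) (N :: nat)"
proof (cases "N \<le> x \<and> y \<noteq> 0")
  case True
  then have "N \<le> N * y" "N \<le> x * y" using mult_le_mono[of N x 1 y] by auto
  with True show ?thesis by (simp add: min_absorb2)
qed (auto simp: min_def)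

interpretation nat: coded_semiring enc_nat "(+)" "(*)"
  by unfold_locales (auto simp: enc_nat_def[abs_def] bij_def min_mult_min intro!: computable_intros)

text \<open>
  The number zero has code 1 and annihilates everything, infinity included; hence the first
  case distinction in the product.
\<close>

interpretation enat: coded_semiring enc_enat
  "\<lambda>x y. if x = 0 \<or> y = 0 then 0 else x + y - 1"
  "\<lambda>x y. if x = 1 \<or> y = 1 then 1 else if x = 0 \<or> y = 0 then 0 else Suc ((x - 1) * (y - 1))"
proof
  show "bij enc_enat"
  proof (rule bijI[OF inj_enc(6)], rule surjI)
    show "enc_enat (if n = 0 then \<infinity> else enat (n - 1)) = n" for n by (simp add: enc_enat_def)
  qed
  show "enc_enat (a + b) = (if enc_enat a = 0 \<or> enc_enat b = 0 then 0
      else enc_enat a + enc_enat b - 1)" for a b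
    by (cases a; cases b) (auto simp: enc_enat_def)
  show "enc_enat (a * b) = (if enc_enat a = 1 \<or> enc_enat b = 1 then 1
      else if enc_enat a = 0 \<or> enc_enat b = 0 then 0
      else Suc ((enc_enat a - 1) * (enc_enat b - 1)))" for a b
    by (cases a; cases b) (auto simp: enc_enat_def zero_enat_def imult_is_infinity)
  fix N x y :: nat assume "3 \<le> N"
  \<comment> \<open>\<open>K\<close> is the threshold for elements that corresponds to the threshold \<open>N\<close> for codes.\<close>
  then obtain K where N: "N = Suc K" "2 \<le> K" by (cases N) auto
  have "min (Suc ((min x N - 1) * (y - 1))) N = min (Suc ((x - 1) * (y - 1))) N"
  proof -
    have "min x N - 1 = min (x - 1) K" using N by auto
    then show ?thesis using min_mult_min[of "x - 1" K "y - 1"] by (simp add: N)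
  qed
  then show "min (if min x N = 1 \<or> y = 1 then 1 else if min x N = 0 \<or> y = 0 then 0
        else Suc ((min x N - 1) * (y - 1))) N =
      min (if x = 1 \<or> y = 1 then 1 else if x = 0 \<or> y = 0 then 0 else Suc ((x - 1) * (y - 1))) N"
    using \<open>3 \<le> N\<close> by (auto simp: min_def)
qed (intro computable_intros | auto simp: min_def)+

theorem corollary5:
  shows
   "decidable (matrix_reachability enc_nmin) \<and>
    decidable (vector_reachability enc_nmin) \<and>
    decidable (scalar_reachability enc_nmin) \<and>
    decidable (matrix_reachability enc_nmax) \<and>
    decidable (vector_reachability enc_nmax) \<and>
    decidable (scalar_reachability enc_nmax) \<and>
    decidable (matrix_reachability enc_nbarmax) \<and>
    decidable (vector_reachability enc_nbarmax) \<and>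
    decidable (scalar_reachability enc_nbarmax) \<and>
    decidable (matrix_reachability enc_lsr) \<and>
    decidable (vector_reachability enc_lsr) \<and>
    decidable (scalar_reachability enc_lsr) \<and>
    decidable (matrix_reachability enc_nat) \<and>
    decidable (vector_reachability enc_nat) \<and>
    decidable (scalar_reachability enc_nat) \<and>
    decidable (matrix_reachability enc_enat) \<and>
    decidable (vector_reachability enc_enat) \<and>
    decidable (scalar_reachability enc_enat)"
  by (intro conjI
      nmin.decidable_matrix_reachability nmin.decidable_vector_reachability
      nmin.decidable_scalar_reachability
      nmax.decidable_matrix_reachability nmax.decidable_vector_reachability
      nmax.decidable_scalar_reachability
      nbarmax.decidable_matrix_reachability nbarmax.decidable_vector_reachability
      nbarmax.decidable_scalar_reachability
      lsr.decidable_matrix_reachability lsr.decidable_vector_reachability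
      lsr.decidable_scalar_reachability
      nat.decidable_matrix_reachability nat.decidable_vector_reachability
      nat.decidable_scalar_reachability
      enat.decidable_matrix_reachability enat.decidable_vector_reachability
      enat.decidable_scalar_reachability)

end
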